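(* Let $\mathfrak{a}=(\mathfrak{a}_s:0\le s\le1)$ be the Brownian ascent and $\mathfrak{m}=(\mathfrak{m}_s:0\le s\le1)$ the Brownian meander. Then $$(\mathfrak{a}_s:0\le s\le1)\stackrel{\mathcal{L}}{=}(\mathfrak{m}_1-\mathfrak{m}_{1-s}:0\le s\le1).$$
   Context: $X$ is standard Brownian motion from $0$ under $P_0$, $S_1=\sup_{s\le1}X_s$. The Brownian ascent $\mathfrak{a}$ is Brownian motion on $[0,1]$ from $0$ conditioned on the null event $\{X_1=S_1\}$, made precise as follows: its law is the weak limit, as $\epsilon\searrow0$, of the law of $(X_s:0\le s\le1)$ under $P_0(\,\cdot\mid S_1-X_1<\epsilon)$ on $\mathcal{C}([0,1];\mathbb{R})$ with the uniform topology. The Brownian meander $\mathfrak{m}$ has the law of $\big(|X_{g_1+s(1-g_1)}|/\sqrt{1-g_1}:0\le s\le1\big)$ under $P_0$, where $g_1=\sup\{t<1:X_t=0\}$. $\stackrel{\mathcal{L}}{=}$ denotes equality in law. *)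

theory Defs
  imports "HOL-Probability.Probability"
begin

abbreviation path_topology :: "(real \<Rightarrow> real) topology" where
  "path_topology \<equiv> mtopology_of (cfunspace (top_of_set {0..1::real}) (euclidean_metric :: real metric))"

definition borel_of :: "'a topology \<Rightarrow> 'a measure" where
  "borel_of T = sigma (topspace T) {U. openin T U}"

abbreviation path_borel :: "(real \<Rightarrow> real) measure" where
  "path_borel \<equiv> borel_of path_topology"

text \<open>A path in \<open>\<C>([0,1];\<real>)\<close> is represented by the function that has the value
  \<^term>\<open>undefined\<close> outside \<open>[0,1]\<close>, and the distance of two paths is the supremum over \<open>[0,1]\<close>.\<close>

lemma space_path_borel:
  "space path_borel = {f. f \<in> extensional {0..1} \<and> continuous_on {0..1} f}"
proof -
  have "compactin (top_of_set {0..1::real}) (topspace (top_of_set {0..1::real}))"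
    by (simp add: compactin_subtopology)
  from compactin_mspace_cfunspace[OF this, of "euclidean_metric :: real metric"]
  have "mspace (cfunspace (top_of_set {0..1::real}) (euclidean_metric :: real metric)) =
          {f. f \<in> extensional {0..1} \<and> continuous_on {0..1} f}"
    by (auto simp: continuous_map_iff_continuous mtopology_of_euclidean)
  then show ?thesis
    by (simp add: borel_of_def space_measure_of_conv)
qed

text \<open>Standard Brownian motion started from 0 under \<open>M\<close>.  Every path starts at 0 and is continuous
  (not only almost every path); the values of \<open>X\<close> at negative times are irrelevant.\<close>

locale standard_brownian_motion = prob_space M for M :: "'w measure" +
  fixes X :: "real \<Rightarrow> 'w \<Rightarrow> real"
  assumes measurable_BM: "\<And>t. 0 \<le> t \<Longrightarrow> X t \<in> borel_measurable M"
    and starts_at_0: "\<And>w. w \<in> space M \<Longrightarrow> X 0 w = 0"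
    and continuous_paths: "\<And>w. w \<in> space M \<Longrightarrow> continuous_on {0..} (\<lambda>t. X t w)"
    and indep_increments: "\<And>(n::nat) (t::nat \<Rightarrow> real). 0 \<le> t 0 \<Longrightarrow> (\<And>i. i < n \<Longrightarrow> t i \<le> t (Suc i)) \<Longrightarrow>
          indep_vars (\<lambda>_. borel) (\<lambda>i w. X (t (Suc i)) w - X (t i) w) {..<n}"
    and gaussian_increments: "\<And>s t. 0 \<le> s \<Longrightarrow> s < t \<Longrightarrow>
          distributed M lborel (\<lambda>w. X t w - X s w) (normal_density 0 (sqrt (t - s)))"

text \<open>Weak convergence of measures on the Borel sets of an arbitrary topological space; the
  library's \<^const>\<open>weak_conv_m\<close> is only available for measures on the real line.\<close>

definition weakly_converges ::
    "'a topology \<Rightarrow> ('i \<Rightarrow> 'a measure) \<Rightarrow> 'a measure \<Rightarrow> 'i filter \<Rightarrow> bool" where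
  "weakly_converges T \<mu> \<nu> F \<longleftrightarrow>
     (\<forall>f::'a \<Rightarrow> real. continuous_map T euclideanreal f \<and> bounded (f ` topspace T) \<longrightarrow>
        ((\<lambda>i. \<integral>x. f x \<partial>\<mu> i) \<longlongrightarrow> (\<integral>x. f x \<partial>\<nu>)) F)"

definition running_sup :: "(real \<Rightarrow> 'w \<Rightarrow> real) \<Rightarrow> real \<Rightarrow> 'w \<Rightarrow> real" where
  "running_sup X t w = (SUP s\<in>{0..t}. X s w)"

text \<open>The law of \<open>(X\<^sub>s : 0 \<le> s \<le> 1)\<close> under \<open>M(\<cdot> | S\<^sub>1 - X\<^sub>1 < \<epsilon>)\<close>.\<close>

definition conditioned_law ::
    "'w measure \<Rightarrow> (real \<Rightarrow> 'w \<Rightarrow> real) \<Rightarrow> real \<Rightarrow> (real \<Rightarrow> real) measure" where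
  "conditioned_law M X \<epsilon> =
     distr (uniform_measure M {w \<in> space M. running_sup X 1 w - X 1 w < \<epsilon>}) path_borel
       (\<lambda>w. \<lambda>s\<in>{0..1}. X s w)"

text \<open>A Brownian ascent is a random path \<open>\<aa>\<close>, on any probability space, whose law is the weak limit
  of the conditioned laws.\<close>

definition brownian_ascent ::
    "'w measure \<Rightarrow> (real \<Rightarrow> 'w \<Rightarrow> real) \<Rightarrow> 'a measure \<Rightarrow> ('a \<Rightarrow> real \<Rightarrow> real) \<Rightarrow> bool" where
  "brownian_ascent M X N \<aa> \<longleftrightarrow>
     prob_space N \<and> \<aa> \<in> N \<rightarrow>\<^sub>M path_borel \<and>
     weakly_converges path_topology (conditioned_law M X) (distr N path_borel \<aa>) (at_right 0)"

definition last_zero :: "(real \<Rightarrow> 'w \<Rightarrow> real) \<Rightarrow> real \<Rightarrow> 'w \<Rightarrow> real" where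
  "last_zero X t w = Sup {s. 0 \<le> s \<and> s < t \<and> X s w = 0}"

text \<open>On the null event \<open>g = 1\<close> the scaled path is constantly 0, since \<open>x / 0 = 0\<close>; hence it
  always lies in \<open>\<C>([0,1];\<real>)\<close>.\<close>

definition brownian_meander ::
    "'w measure \<Rightarrow> (real \<Rightarrow> 'w \<Rightarrow> real) \<Rightarrow> 'b measure \<Rightarrow> ('b \<Rightarrow> real \<Rightarrow> real) \<Rightarrow> bool" where
  "brownian_meander M X N \<mm> \<longleftrightarrow>
     prob_space N \<and> \<mm> \<in> N \<rightarrow>\<^sub>M path_borel \<and>
     distr N path_borel \<mm> =
       distr M path_borel
         (\<lambda>w. let g = last_zero X 1 w in
                (\<lambda>s\<in>{0..1}. \<bar>X (g + s * (1 - g)) w\<bar> / sqrt (1 - g)))"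

end

theory Submission
  imports Defs
begin

text \<open>
  Time reversal turns the event \<open>S\<^sub>1 - X\<^sub>1 < y\<close> into the event that the reversed Brownian motion stays
  above \<open>-y\<close>, so the conditioned laws in the definition of the ascent are reversals of Brownian motion
  conditioned to stay above \<open>-y\<close>.  On the other side, approximate the last zero \<open>g\<close> from above by the
  next point \<open>t\<close> of the grid of mesh \<open>1/N\<close>.  Given the past up to \<open>t\<close>, the path \<open>|X|\<close> on \<open>[t,1]\<close>,
  rescaled to \<open>[0,1]\<close>, is Brownian motion from \<open>y = |X\<^sub>t|/\<surd>(1-t)\<close> conditioned to stay positive.
  The map \<open>f \<mapsto> (s \<mapsto> f(1) - f(1-s))\<close> forgets the starting point, so its image has exactly
  the conditional law of \<open>X\<close> given \<open>S\<^sub>1 - X\<^sub>1 < y\<close>.  As \<open>N \<rightarrow> \<infinity>\<close>, \<open>y\<close> tends to 0 and the rescaled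
  path converges to the meander.  Since the weak limit defining the ascent is assumed to exist, no density
  is needed.
\<close>

text \<open>The obstacle is that the last zero is not a stopping time: its value reveals that no
  zero follows, so the Markov property cannot be applied at that instant. On a grid the difficulty
  disappears. The event that the last zero lies in the cell ending at \<open>t\<close> splits into a
  zero in this cell, which the past decides, and the absence of zeros on [t,1], which is a survival
  condition on the future increments. The sign on [t,1] is fixed as well, so that |X| there is a
  constant multiple of \<open>X\<close>. The height y is itself random and known from the past.
  Hence the conditioned expectation is treated as a bounded measurable function of y, and its limit
  at 0 from the right is inserted by dominated convergence; y is strictly positive because
  \<open>t\<close> lies beyond the last zero. The test functionals depend continuously on finitely
  many coordinates. They are admissible for weak convergence, they determine a law, and they pass to
  the limit along rescaled paths that converge only pointwise.\<close>

definition cylinder :: "(real \<times> real) set \<Rightarrow> (real \<Rightarrow> real) set" where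
  "cylinder J = {f \<in> space path_borel. \<forall>(t, a)\<in>J. f t \<le> a}"

definition rational_cylinders :: "(real \<Rightarrow> real) set set" where
  "rational_cylinders = {cylinder J | J. finite J \<and> J \<subseteq> (\<rat> \<inter> {0..1}) \<times> UNIV}"

section \<open>Borel sets of path space and cylinders at rational times\<close>

lemma space_borel_of: "space (borel_of T) = topspace T"
  by (simp add: borel_of_def space_measure_of_conv)

lemma sets_borel_of: "sets (borel_of T) = sigma_sets (topspace T) {U. openin T U}"
  unfolding borel_of_def by (rule sets_measure_of) (auto dest: openin_subset)

lemma mspace_paths:
  "mspace (cfunspace (top_of_set {0..1::real}) (euclidean_metric :: real metric)) = space path_borel"
  by (simp add: space_borel_of)

lemma mdist_paths_le:
  assumes "f \<in> space path_borel" "g \<in> space path_borel"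
  shows "mdist (cfunspace (top_of_set {0..1::real}) (euclidean_metric :: real metric)) f g \<le> r
    \<longleftrightarrow> (\<forall>t\<in>{0..1}. \<bar>f t - g t\<bar> \<le> r)"
  by (subst cfunspace_mdist_le)
    (use assms in \<open>auto simp: mspace_paths dist_real_def simp del: mspace_cfunspace\<close>)

text \<open>Evaluation is 1-Lipschitz for the supremum distance.\<close>

lemma continuous_map_eval:
  assumes "t \<in> {0..1}"
  shows "continuous_map path_topology euclideanreal (\<lambda>f. f t)"
proof -
  have "Lipschitz_continuous_map (cfunspace (top_of_set {0..1::real}) (euclidean_metric :: real metric))
      (euclidean_metric :: real metric) (\<lambda>f. f t)"
    unfolding Lipschitz_continuous_map_def mspace_paths
  proof (intro conjI exI[of _ 1] ballI)
    fix f g assume fg: "f \<in> space path_borel" "g \<in> space path_borel"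
    show "mdist euclidean_metric (f t) (g t)
       \<le> 1 * mdist (cfunspace (top_of_set {0..1::real}) (euclidean_metric :: real metric)) f g"
      using mdist_paths_le[OF fg, of "mdist (cfunspace (top_of_set {0..1::real}) (euclidean_metric :: real metric)) f g"]
        assms by (simp add: dist_real_def)
  qed auto
  then show ?thesis
    using Lipschitz_continuous_imp_continuous_map[of _ euclidean_metric]
    by (metis mtopology_of_euclidean)
qed

lemma measurable_eval:
  assumes "t \<in> {0..1}"
  shows "(\<lambda>f. f t) \<in> borel_measurable path_borel"
proof (rule borel_measurableI)
  fix S :: "real set" assume "open S"
  then have "openin path_topology {f \<in> topspace path_topology. f t \<in> S}"
    using openin_continuous_map_preimage[OF continuous_map_eval[OF assms], of S] by simp
  moreover have "(\<lambda>f. f t) -` S \<inter> space path_borel = {f \<in> topspace path_topology. f t \<in> S}"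
    by (auto simp: space_borel_of)
  ultimately show "(\<lambda>f. f t) -` S \<inter> space path_borel \<in> sets path_borel"
    by (auto simp only: sets_borel_of intro: sigma_sets.Basic)
qed

text \<open>Supplies the countable dense set behind the separability of path space. Half of
  \<open>e\<close> pays for the Weierstrass polynomial. The other half is shared by its n + 1
  coefficients, since on [0,1] moving one of them by less than \<open>\<delta>\<close> moves the
  value by at most \<open>\<delta>\<close>.\<close>

lemma rational_poly_approx:
  assumes "continuous_on {0..1} f" "(0::real) < e"
  obtains cs :: "rat list" where
    "\<And>t. t \<in> {0..1} \<Longrightarrow> \<bar>f t - (\<Sum>i<length cs. of_rat (cs ! i) * t ^ i)\<bar> \<le> e"
proof -
  obtain g where g: "real_polynomial_function g" "\<And>x. x \<in> {0..1} \<Longrightarrow> \<bar>f x - g x\<bar> < e / 2"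
    using Stone_Weierstrass_real_polynomial_function[OF compact_Icc assms(1), of "e/2"] assms(2) by auto
  obtain a n where gsum: "g = (\<lambda>x. \<Sum>i\<le>n. a i * x ^ i)"
    using g(1) real_polynomial_function_iff_sum by blast
  define \<delta> where "\<delta> = e / (2 * real (Suc n))"
  have "\<delta> > 0" using assms by (simp add: \<delta>_def)
  have "\<exists>q. \<bar>a i - of_rat q\<bar> < \<delta>" for i
    using of_rat_dense[of "a i - \<delta>" "a i + \<delta>"] \<open>\<delta> > 0\<close> by (auto simp: abs_less_iff) (metis add.commute less_diff_eq diff_less_eq)
  then obtain q where q: "\<And>i. \<bar>a i - of_rat (q i)\<bar> < \<delta>" by metis
  define cs where "cs = map q [0..<Suc n]"
  show thesis
  proof
    fix t :: real assume t: "t \<in> {0..1}"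
    have "(\<Sum>i<length cs. of_rat (cs ! i) * t ^ i) = (\<Sum>i\<le>n. of_rat (q i) * t ^ i)"
      by (rule sum.cong) (auto simp: cs_def simp del: upt_Suc)
    then have "\<bar>g t - (\<Sum>i<length cs. of_rat (cs ! i) * t ^ i)\<bar> = \<bar>\<Sum>i\<le>n. (a i - of_rat (q i)) * t ^ i\<bar>"
      by (simp add: gsum sum_subtractf left_diff_distrib)
    also have "\<dots> \<le> (\<Sum>i\<le>n. \<delta>)"
    proof (rule sum_abs[THEN order_trans], rule sum_mono)
      fix i
      have "\<bar>a i - of_rat (q i)\<bar> * t ^ i \<le> \<delta> * 1"
        using q[of i] t by (intro mult_mono) (auto simp: power_le_one)
      then show "\<bar>(a i - of_rat (q i)) * t ^ i\<bar> \<le> \<delta>" using t by (simp add: abs_mult)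
    qed
    also have "\<dots> = e / 2" by (simp add: \<delta>_def field_simps flip: of_nat_Suc)
    finally show "\<bar>f t - (\<Sum>i<length cs. of_rat (cs ! i) * t ^ i)\<bar> \<le> e"
      using g(2)[OF t] by linarith
  qed
qed

lemma closure_Rats_unit: "closure (\<rat> \<inter> {0..1::real}) = {0..1}"
  using closure_convex_Int_superset[of "{0..1::real}" \<rat>] Rats_closure_real by (simp add: Int_commute)

lemma cylinder_in_sigma:
  assumes "finite J" "\<And>t. t \<in> fst ` J \<Longrightarrow> (\<lambda>f. f t) \<in> borel_measurable N" "space N = space path_borel"
  shows "cylinder J \<in> sets N"
proof -
  have "cylinder J = {f \<in> space N. \<forall>x\<in>J. f (fst x) \<le> snd x}"
    using assms(3) by (auto simp: cylinder_def)
  also have "\<dots> \<in> sets N"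
    using assms(1,2) by (intro sets.sets_Collect_finite_All borel_measurable_le) auto
  finally show ?thesis .
qed

text \<open>By separability every open set is a countable union of closed balls around rational
  polynomials, and by continuity membership in such a ball is decided by the values at rational
  times.\<close>

lemma sets_path_borel:
  "sets path_borel = sigma_sets (space path_borel) rational_cylinders"
proof
  have sub: "rational_cylinders \<subseteq> Pow (space path_borel)"
    by (auto simp: rational_cylinders_def cylinder_def)
  show "sigma_sets (space path_borel) rational_cylinders \<subseteq> sets path_borel"
  proof (rule sets.sigma_sets_subset, safe)
    fix C assume "C \<in> rational_cylinders"
    then show "C \<in> sets path_borel"
      unfolding rational_cylinders_def
      by (auto intro!: cylinder_in_sigma measurable_eval)
  qed
  define N where "N = sigma (space path_borel) rational_cylinders"
  have sN: "space N = space path_borel" "sets N = sigma_sets (space path_borel) rational_cylinders"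
    using sub by (auto simp: N_def)
  have ev: "(\<lambda>f. f t) \<in> borel_measurable N" if "t \<in> \<rat> \<inter> {0..1}" for t
  proof (rule borel_measurableI_le)
    fix a
    have "{f \<in> space N. f t \<le> a} = cylinder {(t, a)}" by (auto simp: cylinder_def sN)
    also have "\<dots> \<in> sets N"
      unfolding sN(2) using that by (intro sigma_sets.Basic) (auto simp: rational_cylinders_def)
    finally show "{f \<in> space N. f t \<le> a} \<in> sets N" .
  qed
  define p :: "rat list \<Rightarrow> real \<Rightarrow> real" where "p cs t = (\<Sum>i<length cs. of_rat (cs ! i) * t ^ i)" for cs t
  \<comment> \<open>A closed ball of rational radius around a rational polynomial, tested at
    rational times only, so that it is visibly a countable intersection of coordinate
    conditions.\<close>
  define B where "B = (\<lambda>(cs, q). {f \<in> space N. \<forall>t\<in>\<rat> \<inter> {0..1}. \<bar>f t - p cs t\<bar> \<le> of_rat q})"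
  have B_sets: "B x \<in> sets N" for x
  proof -
    have "B x = {f \<in> space N. \<forall>t\<in>\<rat> \<inter> {0..1}. \<bar>f t - p (fst x) t\<bar> \<le> of_rat (snd x)}"
      by (cases x) (simp add: B_def)
    also have "\<dots> \<in> sets N"
      by (intro sets.sets_Collect_countable_All' borel_measurable_le borel_measurable_abs borel_measurable_diff ev)
        (auto simp: countable_rat)
    finally show ?thesis .
  qed
  have B_all: "\<bar>f t - p cs t\<bar> \<le> of_rat q" if f: "f \<in> B (cs, q)" and t: "t \<in> {0..1}" for f cs q t
  proof -
    have cont: "continuous_on {0..1} f" using f space_path_borel by (auto simp: B_def sN)
    have "t \<in> closure (\<rat> \<inter> {0..1})" using t by (simp add: closure_Rats_unit)
    moreover have "continuous_on (closure (\<rat> \<inter> {0..1})) (\<lambda>t. \<bar>f t - p cs t\<bar>)"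
      unfolding closure_Rats_unit p_def by (intro continuous_intros cont)
    ultimately show ?thesis
      using continuous_le_on_closure[of "\<rat> \<inter> {0..1}" "\<lambda>t. \<bar>f t - p cs t\<bar>" t "of_rat q"] f
      by (auto simp: B_def)
  qed
  have "U \<in> sets N" if U: "openin path_topology U" for U
  proof -
    let ?m = "cfunspace (top_of_set {0..1::real}) (euclidean_metric :: real metric)"
    have "U = \<Union> (B ` {x. B x \<subseteq> U})"
    proof (intro equalityI subsetI)
      fix f assume f: "f \<in> U"
      have U_space: "U \<subseteq> space path_borel"
        using openin_subset[OF U] by (simp only: space_borel_of)
      interpret Metric_space "mspace ?m" "mdist ?m" by (rule Metric_space_mspace_mdist)
      obtain r where r: "r > 0" "mball f r \<subseteq> U"
        using U f unfolding mtopology_of_def openin_mtopology by blast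
      have "f \<in> space path_borel" using f U_space by auto
      then have cont: "continuous_on {0..1} f" using space_path_borel by auto
      obtain cs where cs: "\<And>t. t \<in> {0..1} \<Longrightarrow> \<bar>f t - p cs t\<bar> \<le> r / 4"
        using rational_poly_approx[OF cont, of "r/4"] r unfolding p_def by auto
      \<comment> \<open>The radius exceeds r/4, so the ball contains \<open>f\<close>; it is below
        r/3, so each of its members is within r/4 + r/3 < 2r/3 < r of \<open>f\<close>.\<close>
      obtain q where q: "r / 4 < of_rat q" "of_rat q < r / 3"
        using of_rat_dense[of "r/4" "r/3"] r by auto
      have "f \<in> B (cs, q)"
        using cs q \<open>f \<in> space path_borel\<close> by (force simp: B_def sN)
      moreover have "B (cs, q) \<subseteq> U"
      proof
        fix h assume h: "h \<in> B (cs, q)"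
        have hs: "h \<in> space path_borel" using h by (auto simp: B_def sN)
        have "\<bar>f t - h t\<bar> \<le> 2 * r / 3" if "t \<in> {0..1}" for t
          using cs[OF that] B_all[OF h that] q by linarith
        then have "mdist ?m f h \<le> 2 * r / 3"
          using mdist_paths_le[OF \<open>f \<in> space path_borel\<close> hs] by blast
        then have "h \<in> mball f r"
          unfolding in_mball using r \<open>f \<in> space path_borel\<close> hs
            by (simp add: mspace_paths del: mspace_cfunspace)
        then show "h \<in> U" using r by auto
      qed
      ultimately show "f \<in> \<Union> (B ` {x. B x \<subseteq> U})" by blast
    qed blast
    also have "\<dots> \<in> sets N"
      using B_sets by (intro sets.countable_UN') auto
    finally show ?thesis .
  qed
  then show "sets path_borel \<subseteq> sigma_sets (space path_borel) rational_cylinders"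
    using sets.sigma_sets_subset[of "{U. openin path_topology U}" N]
    unfolding sN sets_borel_of[of path_topology] space_borel_of by blast
qed

lemma measurable_into_paths:
  assumes "\<And>w. w \<in> space N \<Longrightarrow> g w \<in> space path_borel"
    and "\<And>t. t \<in> \<rat> \<inter> {0..1} \<Longrightarrow> (\<lambda>w. g w t) \<in> borel_measurable N"
  shows "g \<in> N \<rightarrow>\<^sub>M path_borel"
proof (rule measurable_sigma_sets[OF sets_path_borel])
  show "rational_cylinders \<subseteq> Pow (space path_borel)"
    by (auto simp: rational_cylinders_def cylinder_def)
  show "g \<in> space N \<rightarrow> space path_borel" using assms(1) by auto
  fix C assume "C \<in> rational_cylinders"
  then obtain J where J: "C = cylinder J" "finite J" "J \<subseteq> (\<rat> \<inter> {0..1}) \<times> UNIV"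
    by (auto simp: rational_cylinders_def)
  have "g -` C \<inter> space N = {w \<in> space N. \<forall>x\<in>J. g w (fst x) \<le> snd x}"
    using assms(1) by (auto simp: J cylinder_def)
  also have "\<dots> \<in> sets N"
    using J by (intro sets.sets_Collect_finite_All borel_measurable_le assms(2)) auto
  finally show "g -` C \<inter> space N \<in> sets N" .
qed

lemma Int_stable_rational_cylinders: "Int_stable rational_cylinders"
proof (rule Int_stableI)
  fix a b assume "a \<in> rational_cylinders" "b \<in> rational_cylinders"
  then obtain J K where "a = cylinder J" "b = cylinder K" "finite (J \<union> K)"
    "J \<union> K \<subseteq> (\<rat> \<inter> {0..1}) \<times> UNIV"
    unfolding rational_cylinders_def by auto
  moreover have "cylinder J \<inter> cylinder K = cylinder (J \<union> K)" by (auto simp: cylinder_def)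
  ultimately show "a \<inter> b \<in> rational_cylinders" unfolding rational_cylinders_def by blast
qed

lemma path_measure_eqI:
  assumes "prob_space \<mu>" "sets \<mu> = sets path_borel" "sets \<nu> = sets path_borel"
    and "\<And>J. finite J \<Longrightarrow> J \<subseteq> (\<rat> \<inter> {0..1}) \<times> UNIV \<Longrightarrow> emeasure \<mu> (cylinder J) = emeasure \<nu> (cylinder J)"
  shows "\<mu> = \<nu>"
proof (rule measure_eqI_generator_eq[OF Int_stable_rational_cylinders, where A = "\<lambda>_. space path_borel"])
  show "rational_cylinders \<subseteq> Pow (space path_borel)"
    by (auto simp: rational_cylinders_def cylinder_def)
  show "sets \<mu> = sigma_sets (space path_borel) rational_cylinders"
    "sets \<nu> = sigma_sets (space path_borel) rational_cylinders"
    using assms sets_path_borel by auto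
  have "cylinder {} = space path_borel" by (simp add: cylinder_def)
  then show "range (\<lambda>_::nat. space path_borel) \<subseteq> rational_cylinders"
    unfolding rational_cylinders_def by (auto intro!: exI[of _ "{}"])
  show "emeasure \<mu> (space path_borel) \<noteq> \<infinity>" for i :: nat
    using prob_space.emeasure_space_1[OF assms(1)] sets_eq_imp_space_eq[OF assms(2)] by simp
  fix X assume "X \<in> rational_cylinders"
  then show "emeasure \<mu> X = emeasure \<nu> X" using assms(4) by (auto simp: rational_cylinders_def)
qed auto

section \<open>Grid increments determine the law of Brownian motion on the unit interval\<close>

text \<open>Puts all times of a rational cylinder on one equidistant grid, so that only increments
  of equal length have to be compared. The induction multiplies denominators.\<close>

lemma Rats_common_grid:
  assumes "finite T" "T \<subseteq> \<rat> \<inter> {0..1::real}"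
  obtains N :: nat where "0 < N" "\<And>t. t \<in> T \<Longrightarrow> \<exists>k\<le>N. t = real k / real N"
proof -
  have "\<exists>N::nat. 0 < N \<and> (\<forall>t\<in>T. \<exists>k\<le>N. t = real k / real N)"
    using assms
  proof (induction T rule: finite_induct)
    case (insert x T)
    then obtain N where N: "0 < N" "\<And>t. t \<in> T \<Longrightarrow> \<exists>k\<le>N. t = real k / real N" by auto
    obtain m n where mn: "n \<noteq> 0" "\<bar>x\<bar> = real m / real n"
      using insert.prems Rats_abs_nat_div_natE[of x] by (metis Int_iff insert_subset)
    have "0 \<le> x" "x \<le> 1" using insert.prems by auto
    then have x: "x = real m / real n" "m \<le> n"
      using mn by (auto simp: divide_le_eq_1)
    have "\<exists>k\<le>N * n. t = real k / real (N * n)" if "t \<in> insert x T" for t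
    proof (cases "t = x")
      case True
      then show ?thesis using N(1) x mn(1) by (intro exI[of _ "N * m"]) auto
    next
      case False
      then obtain k where "k \<le> N" "t = real k / real N" using N(2) \<open>t \<in> insert x T\<close> by auto
      then show ?thesis using mn(1) by (intro exI[of _ "k * n"]) auto
    qed
    then show ?case using N(1) mn(1) by (intro exI[of _ "N * n"]) auto
  qed auto
  then show thesis using that by blast
qed

abbreviation path_of :: "(real \<Rightarrow> 'w \<Rightarrow> real) \<Rightarrow> 'w \<Rightarrow> real \<Rightarrow> real" where
  "path_of Y \<equiv> \<lambda>w. \<lambda>s\<in>{0..1}. Y s w"

lemma path_of_in_space:
  "continuous_on {0..1} (\<lambda>s. Y s w) \<Longrightarrow> path_of Y w \<in> space path_borel"
  unfolding space_path_borel by (auto cong: continuous_on_cong_simp)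

lemma measurable_path_of:
  assumes "\<And>w. w \<in> space N \<Longrightarrow> continuous_on {0..1} (\<lambda>s. Y s w)"
    and "\<And>t. t \<in> {0..1} \<Longrightarrow> Y t \<in> borel_measurable N"
  shows "path_of Y \<in> N \<rightarrow>\<^sub>M path_borel"
  by (rule measurable_into_paths) (use assms in \<open>auto intro!: path_of_in_space\<close>)

text \<open>The constraints of \<^term>\<open>cylinder J\<close> expressed through increments over a grid of mesh \<open>1/N\<close>, for a
  path with grid increments \<open>c * x m, c * x (m + 1), \<dots>\<close>; it is meaningful when all times in
  \<open>J\<close> are multiples of \<open>1/N\<close>.\<close>

definition increment_cylinder :: "nat set \<Rightarrow> nat \<Rightarrow> nat \<Rightarrow> real \<Rightarrow> (real \<times> real) set \<Rightarrow> (nat \<Rightarrow> real) set" where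
  "increment_cylinder I N m c J =
     {x \<in> space (\<Pi>\<^sub>M i\<in>I. borel). \<forall>p\<in>J. c * (\<Sum>i<nat \<lfloor>fst p * real N\<rfloor>. x (m + i)) \<le> snd p}"

lemma sets_increment_cylinder:
  assumes "finite J" "J \<subseteq> {0..1} \<times> UNIV" "{m..<m + N} \<subseteq> I"
  shows "increment_cylinder I N m c J \<in> sets (\<Pi>\<^sub>M i\<in>I. borel)"
proof -
  have "(\<lambda>x. x (m + i)) \<in> borel_measurable (\<Pi>\<^sub>M i\<in>I. borel)"
    if "p \<in> J" "i < nat \<lfloor>fst p * real N\<rfloor>" for p i
  proof -
    have "fst p \<le> 1" using that assms by auto
    then have "fst p * real N \<le> real N" using mult_right_mono[of "fst p" 1 "real N"] by simp
    then have "nat \<lfloor>fst p * real N\<rfloor> \<le> N" by linarith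
    then have "m + i \<in> I" using that assms by auto
    then show ?thesis by (rule measurable_component_singleton)
  qed
  then show ?thesis
    unfolding increment_cylinder_def using assms(1)
    by (intro sets.sets_Collect_finite_All borel_measurable_le borel_measurable_times borel_measurable_sum) auto
qed

text \<open>Telescoping: the value at k/N is the sum of the first k increments. The offset
  \<open>m\<close> and the factor \<open>c\<close> allow the same statement to serve a past that
  starts at index 0 and a rescaled future that starts at index \<open>N\<close>.\<close>

lemma path_cylinder_iff:
  fixes Y :: "real \<Rightarrow> 'w \<Rightarrow> real"
  assumes "0 < N" and grid: "\<And>t. t \<in> fst ` J \<Longrightarrow> \<exists>k\<le>N. t = real k / real N"
    and cont: "continuous_on {0..1} (\<lambda>s. Y s w)"
    and I: "{m..<m + N} \<subseteq> I"
    and incr: "\<And>i. i < N \<Longrightarrow> c * D (m + i) w = Y (real (Suc i) / real N) w - Y (real i / real N) w"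
    and "Y 0 w = 0"
  shows "path_of Y w \<in> cylinder J \<longleftrightarrow> (\<lambda>i\<in>I. D i w) \<in> increment_cylinder I N m c J"
proof -
  have "Y (fst p) w = c * (\<Sum>i<nat \<lfloor>fst p * real N\<rfloor>. (\<lambda>i\<in>I. D i w) (m + i)) \<and> fst p \<in> {0..1}"
    if p: "p \<in> J" for p
  proof -
    obtain k where k: "k \<le> N" "fst p = real k / real N" using grid p by blast
    have "nat \<lfloor>fst p * real N\<rfloor> = k" using k \<open>0 < N\<close> by simp
    then have "c * (\<Sum>i<nat \<lfloor>fst p * real N\<rfloor>. (\<lambda>i\<in>I. D i w) (m + i))
        = (\<Sum>i<k. Y (real (Suc i) / real N) w - Y (real i / real N) w)"
      using k I incr by (auto simp: sum_distrib_left subset_iff intro!: sum.cong)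
    also have "\<dots> = Y (fst p) w"
      using \<open>Y 0 w = 0\<close> by (subst sum_lessThan_telescope) (simp add: k)
    finally show ?thesis using k \<open>0 < N\<close> by (simp add: divide_le_eq_1)
  qed
  then show ?thesis
    using path_of_in_space[of Y w, OF cont]
    by (auto simp: cylinder_def increment_cylinder_def space_PiM split_beta)
qed

text \<open>Asks for independence and normality only over equidistant grids, which is enough to fix
  the law. Both the rescaled future and the time-reversed motion satisfy it.\<close>

locale unit_brownian_motion = prob_space M for M :: "'w measure" +
  fixes Y :: "real \<Rightarrow> 'w \<Rightarrow> real"
  assumes measurable_Y: "\<And>t. t \<in> {0..1} \<Longrightarrow> Y t \<in> borel_measurable M"
    and Y_0: "\<And>w. w \<in> space M \<Longrightarrow> Y 0 w = 0"
    and continuous_Y: "\<And>w. w \<in> space M \<Longrightarrow> continuous_on {0..1} (\<lambda>t. Y t w)"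
    and indep_grid: "\<And>N::nat. 0 < N \<Longrightarrow>
      indep_vars (\<lambda>_. borel) (\<lambda>i w. Y (real (Suc i) / real N) w - Y (real i / real N) w) {..<N}"
    and normal_grid: "\<And>N i::nat. i < N \<Longrightarrow>
      distributed M lborel (\<lambda>w. Y (real (Suc i) / real N) w - Y (real i / real N) w)
        (normal_density 0 (sqrt (1 / real N)))"
begin

lemma measurable_path: "path_of Y \<in> M \<rightarrow>\<^sub>M path_borel"
  by (rule measurable_path_of) (auto intro: continuous_Y measurable_Y)

text \<open>The right-hand side mentions neither \<open>M\<close> nor \<open>Y\<close>, which yields
  uniqueness of the law. It holds because independence turns the joint law of the grid increments
  into a product of centred normal laws of variance 1/N.\<close>

lemma emeasure_cylinder:
  assumes "0 < N" "finite J" and grid: "\<And>t. t \<in> fst ` J \<Longrightarrow> \<exists>k\<le>N. t = real k / real N"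
  shows "emeasure (distr M path_borel (path_of Y)) (cylinder J) =
    emeasure (\<Pi>\<^sub>M i\<in>{..<N}. density lborel (normal_density 0 (sqrt (1 / real N))))
      (increment_cylinder {..<N} N 0 1 J)"
proof -
  let ?D = "\<lambda>i w. Y (real (Suc i) / real N) w - Y (real i / real N) w"
  let ?n = "density lborel (normal_density 0 (sqrt (1 / real N)))"
  have J01: "J \<subseteq> {0..1} \<times> UNIV"
  proof
    fix p assume "p \<in> J"
    then obtain k where "k \<le> N" "fst p = real k / real N" using grid by blast
    then show "p \<in> {0..1} \<times> UNIV" using \<open>0 < N\<close> by (cases p) (auto simp: divide_le_eq_1)
  qed
  have rv: "?D i \<in> borel_measurable M" if "i < N" for i
    using that by (intro borel_measurable_diff measurable_Y) (auto simp: field_simps)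
  have "distr M borel (?D i) = ?n" if "i < N" for i
    using normal_grid[OF that] by (simp add: distributed_def cong: distr_cong)
  then have "(\<Pi>\<^sub>M i\<in>{..<N}. distr M borel (?D i)) = (\<Pi>\<^sub>M i\<in>{..<N}. ?n)"
    by (intro PiM_cong) auto
  moreover have "{..<N} \<noteq> {}" using \<open>0 < N\<close> by auto
  then have "distr M (\<Pi>\<^sub>M i\<in>{..<N}. borel) (\<lambda>w. \<lambda>i\<in>{..<N}. ?D i w) = (\<Pi>\<^sub>M i\<in>{..<N}. distr M borel (?D i))"
    using indep_grid[OF \<open>0 < N\<close>] rv
    by (subst indep_vars_iff_distr_eq_PiM'[of "{..<N}" ?D "\<lambda>_. borel", symmetric]) auto
  ultimately have joint: "distr M (\<Pi>\<^sub>M i\<in>{..<N}. borel) (\<lambda>w. \<lambda>i\<in>{..<N}. ?D i w) = (\<Pi>\<^sub>M i\<in>{..<N}. ?n)"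
    by simp
  have C: "cylinder J \<in> sets path_borel"
    using J01 by (intro cylinder_in_sigma assms measurable_eval) auto
  have I: "increment_cylinder {..<N} N 0 1 J \<in> sets (\<Pi>\<^sub>M i\<in>{..<N}. borel)"
    using J01 assms by (intro sets_increment_cylinder) auto
  have "path_of Y w \<in> cylinder J \<longleftrightarrow> (\<lambda>i\<in>{..<N}. ?D i w) \<in> increment_cylinder {..<N} N 0 1 J"
    if "w \<in> space M" for w
    by (rule path_cylinder_iff[OF assms(1) grid]) (use that continuous_Y Y_0 in auto)
  then have "path_of Y -` cylinder J \<inter> space M
      = (\<lambda>w. \<lambda>i\<in>{..<N}. ?D i w) -` increment_cylinder {..<N} N 0 1 J \<inter> space M"
    by auto
  moreover have "(\<lambda>w. \<lambda>i\<in>{..<N}. ?D i w) \<in> M \<rightarrow>\<^sub>M (\<Pi>\<^sub>M i\<in>{..<N}. borel)"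
    by (rule measurable_restrict) (use rv in auto)
  ultimately show ?thesis
    unfolding joint[symmetric] using C I by (simp add: emeasure_distr measurable_path)
qed

end

lemma unit_brownian_law_unique:
  assumes "unit_brownian_motion M Y" "unit_brownian_motion M' Y'"
  shows "distr M path_borel (path_of Y) = distr M' path_borel (path_of Y')"
proof -
  interpret A: unit_brownian_motion M Y by fact
  interpret B: unit_brownian_motion M' Y' by fact
  show ?thesis
  proof (rule path_measure_eqI)
    show "prob_space (distr M path_borel (path_of Y))"
      by (rule A.prob_space_distr[OF A.measurable_path])
    fix J :: "(real \<times> real) set" assume J: "finite J" "J \<subseteq> (\<rat> \<inter> {0..1}) \<times> UNIV"
    have "finite (fst ` J)" "fst ` J \<subseteq> \<rat> \<inter> {0..1}" using J by auto
    then obtain N :: nat where "0 < N" "\<And>t. t \<in> fst ` J \<Longrightarrow> \<exists>k\<le>N. t = real k / real N"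
      using Rats_common_grid by blast
    then show "emeasure (distr M path_borel (path_of Y)) (cylinder J)
        = emeasure (distr M' path_borel (path_of Y')) (cylinder J)"
      using A.emeasure_cylinder B.emeasure_cylinder J by simp
  qed auto
qed

section \<open>Scaling, time reversal, and independence of past and future\<close>

lemma (in prob_space) indep_vars_reindex:
  assumes ind: "indep_vars (\<lambda>_. N) X I" and h: "inj_on h J" "h ` J \<subseteq> I"
  shows "indep_vars (\<lambda>_. N) (\<lambda>j. X (h j)) J"
  unfolding indep_vars_def2
proof (intro conjI ballI indep_setsI)
  show "random_variable N (X (h j))" if "j \<in> J" for j
    using ind h that by (auto simp: indep_vars_def2)
  then show "{X (h j) -` A \<inter> space M |A. A \<in> sets N} \<subseteq> events" if "j \<in> J" for j
    using that by (auto intro: measurable_sets)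
  fix A K assume K: "K \<noteq> {}" "K \<subseteq> J" "finite K"
    and A: "\<forall>j\<in>K. A j \<in> {X (h j) -` A \<inter> space M |A. A \<in> sets N}"
  have injK: "inj_on h K" using K h inj_on_subset by blast
  define A' where "A' = (\<lambda>i. A (the_inv_into K h i))"
  have A'h: "A' (h j) = A j" if "j \<in> K" for j
    using that injK by (simp add: A'_def the_inv_into_f_f)
  have "prob (\<Inter>i\<in>h ` K. A' i) = (\<Prod>i\<in>h ` K. prob (A' i))"
  proof (rule indep_setsD)
    show "indep_sets (\<lambda>i. {X i -` A \<inter> space M |A. A \<in> sets N}) I"
      using ind by (simp add: indep_vars_def2)
    show "h ` K \<subseteq> I" using K h by auto
    show "\<forall>i\<in>h ` K. A' i \<in> {X i -` A \<inter> space M |A. A \<in> sets N}" using A A'h by auto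
  qed (use K in auto)
  then show "prob (\<Inter>j\<in>K. A j) = (\<Prod>j\<in>K. prob (A j))"
    using A'h by (simp add: prod.reindex[OF injK])
qed

context standard_brownian_motion
begin

lemma continuous_X: "w \<in> space M \<Longrightarrow> S \<subseteq> {0..} \<Longrightarrow> continuous_on S (\<lambda>t. X t w)"
  using continuous_paths continuous_on_subset by blast

lemma continuous_X_compose:
  "w \<in> space M \<Longrightarrow> continuous_on S h \<Longrightarrow> h ` S \<subseteq> {0..} \<Longrightarrow> continuous_on S (\<lambda>t. X (h t) w)"
  by (rule continuous_on_compose2[OF continuous_paths]) auto

text \<open>Brownian scaling. Since \<open>c\<close> is fixed only up to sign, reflection is
  included; it is used when the path is negative after \<open>t\<close>.\<close>

lemma unit_brownian_rescaled:
  assumes "0 \<le> t" "t < 1" "\<bar>c\<bar> * sqrt (1 - t) = 1"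
  shows "unit_brownian_motion M (\<lambda>s w. c * (X (t + (1 - t) * s) w - X t w))"
proof
  have c0: "c \<noteq> 0" using assms by auto
  have nonneg: "0 \<le> t + (1 - t) * s" if "s \<in> {0..1}" for s using assms that by auto
  show "(\<lambda>w. c * (X (t + (1 - t) * s) w - X t w)) \<in> borel_measurable M" if "s \<in> {0..1}" for s
    using nonneg[OF that] assms(1) by (intro borel_measurable_times borel_measurable_diff measurable_BM) auto
  show "continuous_on {0..1} (\<lambda>s. c * (X (t + (1 - t) * s) w - X t w))" if "w \<in> space M" for w
    using nonneg that by (intro continuous_intros continuous_X_compose) auto
  fix N :: nat
  let ?t = "\<lambda>i::nat. t + (1 - t) * (real i / real N)"
  have step: "?t i \<le> ?t (Suc i)" for i
    using assms by (intro add_left_mono mult_left_mono divide_right_mono) auto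
  have eq: "c * (X (?t (Suc i)) w - X t w) - c * (X (?t i) w - X t w)
      = c * (X (?t (Suc i)) w - X (?t i) w)" for i w
    by (simp add: algebra_simps)
  show "indep_vars (\<lambda>_. borel)
      (\<lambda>i w. c * (X (?t (Suc i)) w - X t w) - c * (X (?t i) w - X t w)) {..<N}"
    unfolding eq
    by (rule indep_vars_compose2[OF indep_increments[of ?t N]]) (use assms step in auto)
  fix i :: nat assume i: "i < N"
  have diff: "?t (Suc i) - ?t i = (1 - t) / real N" by (simp add: add_divide_distrib algebra_simps)
  have "?t i < ?t (Suc i)"
    using i \<open>t < 1\<close> by (intro add_strict_left_mono mult_strict_left_mono divide_strict_right_mono) auto
  moreover have "0 \<le> ?t i" using assms by simp
  ultimately have "distributed M lborel (\<lambda>w. X (?t (Suc i)) w - X (?t i) w)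
      (normal_density 0 (sqrt ((1 - t) / real N)))"
    using gaussian_increments[of "?t i" "?t (Suc i)"] by (simp only: diff)
  from normal_density_affine[OF this _ c0, of 0]
  have "distributed M lborel (\<lambda>w. c * (X (?t (Suc i)) w - X (?t i) w))
      (normal_density 0 (\<bar>c\<bar> * sqrt ((1 - t) / real N)))"
    using assms i by simp
  moreover have "\<bar>c\<bar> * sqrt ((1 - t) / real N) = sqrt (1 / real N)"
    using assms(3) by (simp add: real_sqrt_divide)
  ultimately show "distributed M lborel (\<lambda>w. c * (X (?t (Suc i)) w - X t w) - c * (X (?t i) w - X t w))
      (normal_density 0 (sqrt (1 / real N)))"
    unfolding eq by simp
qed auto

text \<open>Increment i of the reversed process is increment N - 1 - i of \<open>X\<close>, and a
  permutation of independent increments with a common law changes nothing.\<close>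

lemma unit_brownian_reversed: "unit_brownian_motion M (\<lambda>s w. X 1 w - X (1 - s) w)"
proof
  show "(\<lambda>w. X 1 w - X (1 - s) w) \<in> borel_measurable M" if "s \<in> {0..1}" for s
    using that by (intro borel_measurable_diff measurable_BM) auto
  show "continuous_on {0..1} (\<lambda>s. X 1 w - X (1 - s) w)" if "w \<in> space M" for w
    using that by (intro continuous_intros continuous_X_compose) auto
  fix N :: nat
  let ?D = "\<lambda>i w. X (real (Suc i) / real N) w - X (real i / real N) w"
  have eq: "X 1 w - X (1 - real (Suc i) / real N) w - (X 1 w - X (1 - real i / real N) w) = ?D (N - Suc i) w"
    if "i < N" for i w
  proof -
    have "1 - real (Suc i) / real N = real (N - Suc i) / real N"
      "1 - real i / real N = real (Suc (N - Suc i)) / real N"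
      using that by (auto simp: field_simps of_nat_diff)
    then show ?thesis by simp
  qed
  show "indep_vars (\<lambda>_. borel)
      (\<lambda>i w. X 1 w - X (1 - real (Suc i) / real N) w - (X 1 w - X (1 - real i / real N) w)) {..<N}"
  proof (subst indep_vars_cong[OF refl _ refl])
    show "indep_vars (\<lambda>_. borel) (\<lambda>i. ?D (N - Suc i)) {..<N}"
      by (rule indep_vars_reindex[OF indep_increments[of "\<lambda>i. real i / real N" N]])
        (auto simp: inj_on_def divide_right_mono)
  qed (use eq in auto)
  fix i :: nat assume i: "i < N"
  have "distributed M lborel (?D (N - Suc i))
      (normal_density 0 (sqrt (real (Suc (N - Suc i)) / real N - real (N - Suc i) / real N)))"
    using i by (intro gaussian_increments) (auto simp: divide_strict_right_mono)
  moreover have "real (Suc (N - Suc i)) / real N - real (N - Suc i) / real N = 1 / real N"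
    by (simp add: add_divide_distrib)
  ultimately show "distributed M lborel (\<lambda>w. X 1 w - X (1 - real (Suc i) / real N) w - (X 1 w - X (1 - real i / real N) w))
      (normal_density 0 (sqrt (1 / real N)))"
    unfolding eq[OF i] by simp
qed auto

text \<open>On rational cylinders past and future are functions of disjoint blocks of increments.
  The preimages of cylinders form intersection-stable families, so independence extends to the
  generated sigma-algebras.\<close>

lemma indep_past_future:
  assumes t: "0 < t" "t < 1"
  shows "indep_var path_borel (path_of (\<lambda>s. X (t * s)))
    path_borel (path_of (\<lambda>s w. c * (X (t + (1 - t) * s) w - X t w)))"
    (is "indep_var _ (path_of ?P) _ (path_of ?Z)")
proof -
  have future_nonneg: "0 \<le> t + (1 - t) * s" if "s \<in> {0..1}" for s using t that by auto
  have contP: "continuous_on {0..1} (\<lambda>s. ?P s w)" if "w \<in> space M" for w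
    using that t by (intro continuous_intros continuous_X_compose) auto
  have contZ: "continuous_on {0..1} (\<lambda>s. ?Z s w)" if "w \<in> space M" for w
    using that future_nonneg by (intro continuous_intros continuous_X_compose) auto
  have mP: "path_of ?P \<in> M \<rightarrow>\<^sub>M path_borel"
    using t contP by (intro measurable_path_of measurable_BM) auto
  have mZ: "path_of ?Z \<in> M \<rightarrow>\<^sub>M path_borel"
    using t contZ future_nonneg
    by (intro measurable_path_of borel_measurable_times borel_measurable_diff measurable_BM) auto
  define G where "G = (\<lambda>U::'w \<Rightarrow> real \<Rightarrow> real. {U -` C \<inter> space M | C. C \<in> rational_cylinders})"
  have stable: "Int_stable (G U)" for U
  proof (rule Int_stableI)
    fix a b assume "a \<in> G U" "b \<in> G U"
    then obtain C D where "a = U -` C \<inter> space M" "C \<in> rational_cylinders"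
      "b = U -` D \<inter> space M" "D \<in> rational_cylinders" by (auto simp: G_def)
    then have "a \<inter> b = U -` (C \<inter> D) \<inter> space M" "C \<inter> D \<in> rational_cylinders"
      using Int_stable_rational_cylinders by (auto simp: Int_stable_def)
    then show "a \<inter> b \<in> G U" unfolding G_def by blast
  qed
  have cyl_sets: "C \<in> sets path_borel" if "C \<in> rational_cylinders" for C
    using that unfolding sets_path_borel by (rule sigma_sets.Basic)
  have "indep_set (G (path_of ?P)) (G (path_of ?Z))"
  proof (rule indep_setI)
    show "G (path_of ?P) \<subseteq> events" "G (path_of ?Z) \<subseteq> events"
      unfolding G_def by (safe; rule measurable_sets[OF mP] measurable_sets[OF mZ]; rule cyl_sets; assumption)+
    fix a b assume "a \<in> G (path_of ?P)" "b \<in> G (path_of ?Z)"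
    then obtain J K where J: "a = path_of ?P -` cylinder J \<inter> space M" "finite J" "J \<subseteq> (\<rat> \<inter> {0..1}) \<times> UNIV"
      and K: "b = path_of ?Z -` cylinder K \<inter> space M" "finite K" "K \<subseteq> (\<rat> \<inter> {0..1}) \<times> UNIV"
      by (auto simp: G_def rational_cylinders_def)
    have "finite (fst ` (J \<union> K))" "fst ` (J \<union> K) \<subseteq> \<rat> \<inter> {0..1}" using J K by auto
    then obtain N :: nat where N: "0 < N" "\<And>s. s \<in> fst ` (J \<union> K) \<Longrightarrow> \<exists>k\<le>N. s = real k / real N"
      using Rats_common_grid by metis
    \<comment> \<open>One grid of 2N steps adapted to \<open>t\<close>: \<open>N\<close> equal steps
      across [0,t], then \<open>N\<close> equal steps across [t,1]. Both formulas give
      \<open>t\<close> at i = N, and each half becomes the mesh 1/N grid after rescaling to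
      [0,1].\<close>
    define \<tau> where "\<tau> i = (if i \<le> N then t * (real i / real N) else t + (1 - t) * ((real i - real N) / real N))"
      for i :: nat
    have \<tau>_future: "\<tau> (N + i) = t + (1 - t) * (real i / real N)" for i
      using N(1) by (cases "i = 0") (auto simp: \<tau>_def)
    have \<tau>_past: "\<tau> i = t * (real i / real N)" if "i \<le> N" for i using that by (simp add: \<tau>_def)
    have mono: "\<tau> i \<le> \<tau> (Suc i)" for i
    proof (cases "i < N")
      case True
      then show ?thesis using t by (auto simp: \<tau>_past intro!: mult_left_mono divide_right_mono)
    next
      case False
      then obtain j where "i = N + j" by (metis le_add_diff_inverse linorder_not_less)
      then show ?thesis using \<tau>_future[of j] \<tau>_future[of "Suc j"] t
        by (auto intro!: mult_left_mono divide_right_mono)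
    qed
    define D where "D i w = X (\<tau> (Suc i)) w - X (\<tau> i) w" for i w
    have "\<tau> 0 = 0" by (simp add: \<tau>_def)
    then have "indep_vars (\<lambda>_. borel) D {..<2 * N}"
      unfolding D_def[abs_def] using mono by (intro indep_increments) auto
    then have ind: "indep_var (\<Pi>\<^sub>M i\<in>{..<N}. borel) (\<lambda>w. \<lambda>i\<in>{..<N}. D i w)
        (\<Pi>\<^sub>M i\<in>{N..<2 * N}. borel) (\<lambda>w. \<lambda>i\<in>{N..<2 * N}. D i w)"
      by (rule indep_var_restrict) auto
    let ?A = "increment_cylinder {..<N} N 0 1 J"
    let ?B = "increment_cylinder {N..<2 * N} N N c K"
    have "path_of ?P w \<in> cylinder J \<longleftrightarrow> (\<lambda>i\<in>{..<N}. D i w) \<in> ?A" if "w \<in> space M" for w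
    proof (rule path_cylinder_iff[OF N(1)])
      show "1 * D (0 + i) w = X (t * (real (Suc i) / real N)) w - X (t * (real i / real N)) w" if "i < N" for i
        using that by (simp add: D_def \<tau>_past)
    qed (use that N contP starts_at_0 in auto)
    then have a: "a = (\<lambda>w. \<lambda>i\<in>{..<N}. D i w) -` ?A \<inter> space M" unfolding J by auto
    have "path_of ?Z w \<in> cylinder K \<longleftrightarrow> (\<lambda>i\<in>{N..<2 * N}. D i w) \<in> ?B" if "w \<in> space M" for w
    proof (rule path_cylinder_iff[OF N(1)])
      show "c * D (N + i) w = c * (X (t + (1 - t) * (real (Suc i) / real N)) w - X t w)
          - c * (X (t + (1 - t) * (real i / real N)) w - X t w)" if "i < N" for i
        using \<tau>_future[of i] \<tau>_future[of "Suc i"] by (simp add: D_def algebra_simps)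
    qed (use that N contZ starts_at_0 in auto)
    then have b: "b = (\<lambda>w. \<lambda>i\<in>{N..<2 * N}. D i w) -` ?B \<inter> space M" unfolding K by auto
    have "?A \<in> sets (\<Pi>\<^sub>M i\<in>{..<N}. borel)" "?B \<in> sets (\<Pi>\<^sub>M i\<in>{N..<2 * N}. borel)"
      using J K by (auto intro!: sets_increment_cylinder)
    from indep_varD[OF ind this]
    moreover have "(\<lambda>w. (\<lambda>i\<in>{..<N}. D i w, \<lambda>i\<in>{N..<2 * N}. D i w)) -` (?A \<times> ?B) \<inter> space M = a \<inter> b"
      unfolding a b by auto
    ultimately show "prob (a \<inter> b) = prob a * prob b" unfolding a b by simp
  qed
  then have "indep_set (sigma_sets (space M) (G (path_of ?P))) (sigma_sets (space M) (G (path_of ?Z)))"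
    by (rule indep_set_sigma_sets) (rule stable)+
  moreover have "sigma_sets (space M) {U -` C \<inter> space M | C. C \<in> sets path_borel} = sigma_sets (space M) (G U)"
    if "U \<in> M \<rightarrow>\<^sub>M path_borel" for U
  proof -
    have "{U -` C \<inter> space M | C. C \<in> sets path_borel} = sigma_sets (space M) (G U)"
      unfolding G_def sets_path_borel
      by (rule sigma_sets_vimage_commute) (use measurable_space[OF that] in auto)
    moreover have "G U \<subseteq> Pow (space M)" by (auto simp: G_def)
    ultimately show ?thesis by (simp add: sigma_sets_sigma_sets_eq)
  qed
  ultimately show ?thesis
    unfolding indep_var_eq using mP mZ by simp
qed

end

section \<open>Measurability of conditions on uncountably many times\<close>

text \<open>On a compact set a positive continuous function has a positive minimum, hence a lower
  bound 1/(m+1). Unlike strict positivity, this non-strict bound extends from a countable dense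
  subset to the whole set.\<close>

lemma sets_positive_on_compact:
  fixes Y :: "real \<Rightarrow> 'w \<Rightarrow> real"
  assumes "compact S"
    and cont: "\<And>w. w \<in> space N \<Longrightarrow> continuous_on S (\<lambda>s. Y s w)"
    and meas: "\<And>s. s \<in> S \<Longrightarrow> Y s \<in> borel_measurable N"
  shows "{w \<in> space N. \<forall>s\<in>S. 0 < Y s w} \<in> sets N"
proof -
  obtain T where T: "countable T" "T \<subseteq> S" "S \<subseteq> closure T"
    using separable[of S] by metis
  have "(\<forall>s\<in>S. 0 < Y s w) \<longleftrightarrow> (\<exists>m::nat. \<forall>s\<in>T. 1 / real (Suc m) \<le> Y s w)" if w: "w \<in> space N" for w
  proof (cases "S = {}")
    case False
    show ?thesis
    proof
      assume pos: "\<forall>s\<in>S. 0 < Y s w"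
      obtain s where s: "s \<in> S" "\<And>u. u \<in> S \<Longrightarrow> Y s w \<le> Y u w"
        using continuous_attains_inf[OF \<open>compact S\<close> False cont[OF w]] by auto
      obtain m where "1 / real (Suc m) < Y s w"
        using reals_Archimedean[of "Y s w"] pos s(1) by (auto simp: inverse_eq_divide)
      then have "\<forall>u\<in>T. 1 / real (Suc m) \<le> Y u w" using s(2) T(2) by (meson less_imp_le order_trans subsetD)
      then show "\<exists>m::nat. \<forall>s\<in>T. 1 / real (Suc m) \<le> Y s w" by blast
    next
      assume "\<exists>m::nat. \<forall>s\<in>T. 1 / real (Suc m) \<le> Y s w"
      then obtain m :: nat where m: "\<forall>s\<in>T. 1 / real (Suc m) \<le> Y s w" by blast
      have cl: "closure T = S"
        using T \<open>compact S\<close> by (intro equalityI closure_minimal compact_imp_closed) auto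
      have "1 / real (Suc m) \<le> Y s w" if "s \<in> S" for s
        using continuous_ge_on_closure[of T "\<lambda>s. Y s w" s] cont[OF w] m that cl by auto
      moreover have "0 < 1 / real (Suc m)" by simp
      ultimately show "\<forall>s\<in>S. 0 < Y s w" by (meson less_le_trans)
    qed
  qed (use T in auto)
  then have "{w \<in> space N. \<forall>s\<in>S. 0 < Y s w} = {w \<in> space N. \<exists>m::nat. \<forall>s\<in>T. 1 / real (Suc m) \<le> Y s w}"
    by auto
  also have "\<dots> \<in> sets N"
    using T meas
    by (intro sets.sets_Collect_countable_Ex sets.sets_Collect_countable_All' borel_measurable_le) auto
  finally show ?thesis .
qed

lemma sets_has_zero_on_compact:
  fixes Y :: "real \<Rightarrow> 'w \<Rightarrow> real"
  assumes "compact S"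
    and cont: "\<And>w. w \<in> space N \<Longrightarrow> continuous_on S (\<lambda>s. Y s w)"
    and meas: "\<And>s. s \<in> S \<Longrightarrow> Y s \<in> borel_measurable N"
  shows "{w \<in> space N. \<exists>s\<in>S. Y s w = 0} \<in> sets N"
proof -
  have "{w \<in> space N. \<exists>s\<in>S. Y s w = 0} = space N - {w \<in> space N. \<forall>s\<in>S. 0 < \<bar>Y s w\<bar>}" by auto
  also have "\<dots> \<in> sets N"
    using assms by (intro sets.compl_sets sets_positive_on_compact continuous_on_rabs) auto
  finally show ?thesis .
qed

text \<open>Null \<open>A\<close> is covered too: the density 1/0 is infinite only on a null set, so
  the left side is 0, and so is the real quotient by 0. Levels y at which the conditioning event is
  null thus need no separate formula.\<close>

lemma (in finite_measure) integral_uniform_measure: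
  fixes f :: "'a \<Rightarrow> real"
  assumes A: "A \<in> sets M" and f: "f \<in> borel_measurable M"
  shows "(\<integral>x. f x \<partial>uniform_measure M A) = (\<integral>x. indicator A x * f x \<partial>M) / measure M A"
proof -
  have "AE x in M. indicator A x / emeasure M A = ennreal (indicator A x / measure M A)"
  proof (cases "measure M A = 0")
    case True
    then have "A \<in> null_sets M" using A by (auto simp: emeasure_eq_measure)
    then have "AE x in M. x \<notin> A" by (rule AE_not_in)
    then show ?thesis by eventually_elim (simp add: True)
  next
    case False
    then have "0 < measure M A" by (simp add: zero_less_measure_iff)
    then show ?thesis
      by (intro AE_I2) (auto simp: emeasure_eq_measure indicator_def divide_ennreal ennreal_1[symmetric] simp del: ennreal_1)
  qed
  then have "uniform_measure M A = density M (\<lambda>x. ennreal (indicator A x / measure M A))"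
    unfolding uniform_measure_def by (intro density_cong) (use A in auto)
  then have "(\<integral>x. f x \<partial>uniform_measure M A) = (\<integral>x. (indicator A x / measure M A) *\<^sub>R f x \<partial>M)"
    using A f by (simp add: integral_density)
  also have "\<dots> = (\<integral>x. (indicator A x * f x) / measure M A \<partial>M)"
    by (intro Bochner_Integration.integral_cong) auto
  finally show ?thesis by simp
qed

section \<open>The conditioned laws expressed through Wiener measure\<close>

text \<open>Applied twice it gives f s - f 0, so it is an involution on paths from 0.\<close>

definition path_reversal :: "(real \<Rightarrow> real) \<Rightarrow> real \<Rightarrow> real" where
  "path_reversal f = (\<lambda>s\<in>{0..1}. f 1 - f (1 - s))"

lemma path_reversal_in_space:
  assumes "f \<in> space path_borel"
  shows "path_reversal f \<in> space path_borel"
proof -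
  have "continuous_on {0..1} f" using assms space_path_borel by auto
  then have "continuous_on {0..1} (\<lambda>s. f (1 - s))"
    by (rule continuous_on_compose2) (auto intro!: continuous_intros)
  then have "continuous_on {0..1} (\<lambda>s. f 1 - f (1 - s))"
    by (intro continuous_on_diff continuous_on_const)
  then show ?thesis
    unfolding path_reversal_def by (rule path_of_in_space[where Y = "\<lambda>s f. f 1 - f (1 - s)"])
qed

lemma measurable_path_reversal: "path_reversal \<in> path_borel \<rightarrow>\<^sub>M path_borel"
proof (rule measurable_into_paths)
  fix t :: real assume t: "t \<in> \<rat> \<inter> {0..1}"
  then have "(\<lambda>f. f 1 - f (1 - t)) \<in> borel_measurable path_borel"
    by (intro borel_measurable_diff measurable_eval) auto
  then show "(\<lambda>f. path_reversal f t) \<in> borel_measurable path_borel"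
    using t by (simp add: path_reversal_def)
qed (rule path_reversal_in_space)

definition paths_above :: "real \<Rightarrow> (real \<Rightarrow> real) set" where
  "paths_above y = {z \<in> space path_borel. \<forall>s\<in>{0..1}. 0 < y + z s}"

text \<open>The level moves with the first coordinate: joint measurability is what Fubini requires
  once the level is a function of the past.\<close>

lemma sets_above_pair:
  assumes "h \<in> borel_measurable L"
  shows "{q \<in> space (L \<Otimes>\<^sub>M path_borel). snd q \<in> paths_above (h (fst q))} \<in> sets (L \<Otimes>\<^sub>M path_borel)"
proof -
  have "{q \<in> space (L \<Otimes>\<^sub>M path_borel). snd q \<in> paths_above (h (fst q))}
      = {q \<in> space (L \<Otimes>\<^sub>M path_borel). \<forall>s\<in>{0..1}. 0 < h (fst q) + snd q s}"
  proof (intro Collect_cong conj_cong refl)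
    fix q assume "q \<in> space (L \<Otimes>\<^sub>M path_borel)"
    then have "snd q \<in> space path_borel" by (rule measurable_space[OF measurable_snd])
    then show "snd q \<in> paths_above (h (fst q)) \<longleftrightarrow> (\<forall>s\<in>{0..1}. 0 < h (fst q) + snd q s)"
      unfolding paths_above_def by blast
  qed
  also have "\<dots> \<in> sets (L \<Otimes>\<^sub>M path_borel)"
  proof (rule sets_positive_on_compact)
    fix q assume "q \<in> space (L \<Otimes>\<^sub>M path_borel)"
    then have "snd q \<in> space path_borel" by (rule measurable_space[OF measurable_snd])
    then have "continuous_on {0..1} (snd q)" unfolding space_path_borel by blast
    then show "continuous_on {0..1} (\<lambda>s. h (fst q) + snd q s)"
      by (rule continuous_on_add[OF continuous_on_const])
  next
    show "(\<lambda>q. h (fst q) + snd q s) \<in> borel_measurable (L \<Otimes>\<^sub>M path_borel)" if "s \<in> {0..1}" for s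
      by (rule borel_measurable_add[OF measurable_compose[OF measurable_fst assms]
            measurable_compose[OF measurable_snd measurable_eval[OF that]]])
  qed simp
  finally show ?thesis .
qed

lemma sets_paths_above: "paths_above y \<in> sets path_borel"
  unfolding paths_above_def
proof (rule sets_positive_on_compact)
  show "continuous_on {0..1} (\<lambda>s. y + z s)" if "z \<in> space path_borel" for z
    using that space_path_borel by (intro continuous_on_add continuous_on_const) auto
qed (auto intro!: borel_measurable_add measurable_eval)

context standard_brownian_motion
begin

text \<open>By \<open>unit_brownian_law_unique\<close> this is Wiener measure on [0,1]. It is
  written through the reversed motion because the conditioning event is then the preimage of
  \<open>paths_above y\<close>.\<close>

abbreviation reversed_law :: "(real \<Rightarrow> real) measure" where
  "reversed_law \<equiv> distr M path_borel (path_of (\<lambda>s w. X 1 w - X (1 - s) w))"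

lemma measurable_reversed: "path_of (\<lambda>s w. X 1 w - X (1 - s) w) \<in> M \<rightarrow>\<^sub>M path_borel"
  by (rule unit_brownian_motion.measurable_path[OF unit_brownian_reversed])

lemma prob_space_reversed_law: "prob_space reversed_law"
  by (rule prob_space_distr[OF measurable_reversed])

lemma measurable_path_X: "path_of X \<in> M \<rightarrow>\<^sub>M path_borel"
  by (rule measurable_path_of) (auto intro: continuous_X measurable_BM)

text \<open>The supremum is attained on [0,1], so a strict bound on it is the same as a strict bound
  at every time.\<close>

lemma running_sup_less_iff:
  assumes w: "w \<in> space M"
  shows "running_sup X 1 w - X 1 w < y \<longleftrightarrow> path_of (\<lambda>s w. X 1 w - X (1 - s) w) w \<in> paths_above y"
proof -
  have cont: "continuous_on {0..1} (\<lambda>s. X s w)" using w by (rule continuous_X) auto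
  obtain u where u: "u \<in> {0..1}" "\<And>s. s \<in> {0..1} \<Longrightarrow> X s w \<le> X u w"
    using continuous_attains_sup[OF compact_Icc _ cont] by auto
  have "running_sup X 1 w = X u w"
    unfolding running_sup_def using u by (intro cSup_eq_maximum) auto
  then have "running_sup X 1 w - X 1 w < y \<longleftrightarrow> (\<forall>s\<in>{0..1}. X s w < y + X 1 w)"
    using u by (auto simp: algebra_simps) (meson atLeastAtMost_iff le_less_trans)
  also have "\<dots> \<longleftrightarrow> (\<forall>s\<in>{0..1}. X (1 - s) w < y + X 1 w)"
  proof
    assume R: "\<forall>s\<in>{0..1}. X (1 - s) w < y + X 1 w"
    show "\<forall>s\<in>{0..1}. X s w < y + X 1 w"
    proof
      fix s :: real assume "s \<in> {0..1}"
      then show "X s w < y + X 1 w" using R[rule_format, of "1 - s"] by auto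
    qed
  qed auto
  also have "\<dots> \<longleftrightarrow> path_of (\<lambda>s w. X 1 w - X (1 - s) w) w \<in> paths_above y"
    using measurable_space[OF measurable_reversed w]
    by (auto simp: paths_above_def algebra_simps)
  finally show ?thesis .
qed

lemma integral_conditioned_law:
  fixes F :: "(real \<Rightarrow> real) \<Rightarrow> real"
  assumes F: "F \<in> borel_measurable path_borel"
  shows "(\<integral>f. F f \<partial>conditioned_law M X y) =
    (\<integral>z. indicator (paths_above y) z * F (path_reversal z) \<partial>reversed_law) / measure reversed_law (paths_above y)"
proof -
  let ?R = "path_of (\<lambda>s w. X 1 w - X (1 - s) w)"
  let ?E = "{w \<in> space M. running_sup X 1 w - X 1 w < y}"
  have E: "?E = ?R -` paths_above y \<inter> space M"
    using running_sup_less_iff by auto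
  then have E_sets: "?E \<in> events"
    using measurable_sets[OF measurable_reversed sets_paths_above] by simp
  have twice: "path_reversal (?R w) = path_of X w" if "w \<in> space M" for w
    using starts_at_0[OF that] by (auto simp: path_reversal_def fun_eq_iff)
  have FX: "(\<lambda>w. F (path_of X w)) \<in> borel_measurable M"
    by (rule measurable_compose[OF measurable_path_X F])
  have "(\<integral>f. F f \<partial>conditioned_law M X y) = (\<integral>w. F (path_of X w) \<partial>uniform_measure M ?E)"
    unfolding conditioned_law_def using F measurable_path_X
    by (intro integral_distr) (simp_all cong: measurable_cong_sets)
  also have "\<dots> = (\<integral>w. indicator ?E w * F (path_of X w) \<partial>M) / prob ?E"
    by (rule integral_uniform_measure[OF E_sets FX])
  also have "(\<integral>w. indicator ?E w * F (path_of X w) \<partial>M)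
      = (\<integral>w. indicator (paths_above y) (?R w) * F (path_reversal (?R w)) \<partial>M)"
    by (intro Bochner_Integration.integral_cong refl) (use running_sup_less_iff twice in \<open>auto simp: indicator_def\<close>)
  also have "\<dots> = (\<integral>z. indicator (paths_above y) z * F (path_reversal z) \<partial>reversed_law)"
    by (subst integral_distr[OF measurable_reversed])
      (use measurable_compose[OF measurable_path_reversal F] sets_paths_above in auto)
  also have "prob ?E = measure reversed_law (paths_above y)"
    unfolding E by (rule measure_distr[OF measurable_reversed sets_paths_above, symmetric])
  finally show ?thesis .
qed

lemma measurable_integral_above:
  fixes g :: "(real \<Rightarrow> real) \<Rightarrow> real"
  assumes g: "g \<in> borel_measurable path_borel"
  shows "(\<lambda>y. \<integral>z. indicator (paths_above y) z * g z \<partial>reversed_law) \<in> borel_measurable borel"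
proof -
  interpret R: prob_space reversed_law by (rule prob_space_reversed_law)
  have "{q \<in> space (borel \<Otimes>\<^sub>M path_borel). snd q \<in> paths_above (fst q)} \<in> sets (borel \<Otimes>\<^sub>M path_borel)"
    using sets_above_pair[of "\<lambda>x. x" borel] by simp
  then have "(\<lambda>q. indicator {q \<in> space (borel \<Otimes>\<^sub>M path_borel). snd q \<in> paths_above (fst q)} q * g (snd q))
      \<in> borel_measurable (borel \<Otimes>\<^sub>M path_borel)"
    using measurable_compose[OF measurable_snd g] by (intro borel_measurable_times borel_measurable_indicator) auto
  also have "?this \<longleftrightarrow> (\<lambda>(y, z). indicator (paths_above y) z * g z) \<in> borel_measurable (borel \<Otimes>\<^sub>M path_borel)"
    by (intro measurable_cong) (auto simp: indicator_def space_pair_measure)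
  finally have "(\<lambda>(y, z). indicator (paths_above y) z * g z) \<in> borel_measurable (borel \<Otimes>\<^sub>M reversed_law)"
    by (simp cong: measurable_cong_sets sets_pair_measure_cong)
  from R.borel_measurable_lebesgue_integral[OF this] show ?thesis by simp
qed

text \<open>Allows the conditioned expectation to be evaluated at a random level.\<close>

lemma measurable_integral_conditioned_law:
  fixes F :: "(real \<Rightarrow> real) \<Rightarrow> real"
  assumes F: "F \<in> borel_measurable path_borel"
  shows "(\<lambda>y. \<integral>f. F f \<partial>conditioned_law M X y) \<in> borel_measurable borel"
proof -
  interpret R: prob_space reversed_law by (rule prob_space_reversed_law)
  have "measure reversed_law (paths_above y) = (\<integral>z. indicator (paths_above y) z * 1 \<partial>reversed_law)" for y
    using sets_paths_above by simp
  then show ?thesis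
    unfolding integral_conditioned_law[OF F]
    using measurable_integral_above[OF measurable_compose[OF measurable_path_reversal F]]
      measurable_integral_above[of "\<lambda>_. 1"] by auto
qed

text \<open>Both parts follow from bounding the numerator by \<open>B\<close> times the probability
  of \<open>paths_above y\<close>. If that probability is 0, the numerator vanishes as well, so
  multiplying out the quotient is valid for every y.\<close>

lemma
  fixes F :: "(real \<Rightarrow> real) \<Rightarrow> real"
  assumes F: "F \<in> borel_measurable path_borel" and bound: "\<And>f. \<bar>F f\<bar> \<le> B"
  shows abs_integral_conditioned_law_le: "\<bar>\<integral>f. F f \<partial>conditioned_law M X y\<bar> \<le> B" (is ?bound)
    and integral_above_eq: "(\<integral>z. indicator (paths_above y) z * F (path_reversal z) \<partial>reversed_law)
      = measure reversed_law (paths_above y) * (\<integral>f. F f \<partial>conditioned_law M X y)" (is ?eq)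
proof -
  interpret R: prob_space reversed_law by (rule prob_space_reversed_law)
  let ?n = "\<integral>z. indicator (paths_above y) z * F (path_reversal z) \<partial>reversed_law"
  \<comment> \<open>Any path serves here: the bound on an absolute value forces \<open>B\<close> to
    be nonnegative.\<close>
  have "0 \<le> B" using bound[of undefined] by linarith
  have m: "(\<lambda>z. indicator (paths_above y) z * F (path_reversal z)) \<in> borel_measurable reversed_law"
    using measurable_compose[OF measurable_path_reversal F] sets_paths_above by auto
  have "\<bar>?n\<bar> \<le> (\<integral>z. \<bar>indicator (paths_above y) z * F (path_reversal z)\<bar> \<partial>reversed_law)"
    by (rule integral_abs_bound)
  also have "\<dots> \<le> (\<integral>z. indicator (paths_above y) z * B \<partial>reversed_law)"
  proof (rule integral_mono)
    show "integrable reversed_law (\<lambda>z. \<bar>indicator (paths_above y) z * F (path_reversal z)\<bar>)"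
      using bound \<open>0 \<le> B\<close>
      by (intro R.integrable_const_bound[where B = B] borel_measurable_abs m) (auto simp: indicator_def abs_mult)
    show "integrable reversed_law (\<lambda>z. indicator (paths_above y) z * B)"
      using sets_paths_above by (intro R.integrable_const_bound[where B = B]) (auto simp: indicator_def \<open>0 \<le> B\<close>)
  qed (use bound in \<open>auto simp: indicator_def\<close>)
  also have "\<dots> = measure reversed_law (paths_above y) * B"
    using sets_paths_above by simp
  finally have n: "\<bar>?n\<bar> \<le> measure reversed_law (paths_above y) * B" .
  show ?eq unfolding integral_conditioned_law[OF F] using n by auto
  show ?bound unfolding integral_conditioned_law[OF F] abs_divide
    using n \<open>0 \<le> B\<close> by (cases "measure reversed_law (paths_above y) = 0")
      (auto simp: divide_le_eq mult.commute zero_less_measure_iff)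
qed

text \<open>The Markov property at time \<open>t\<close>.  The condition on \<open>[a,t]\<close> depends on the past only, and the one on
  \<open>[t,1]\<close> says that the rescaled future increments stay above \<open>-|X\<^sub>t|/\<surd>(1-t)\<close>.\<close>

lemma excursion_conditioning:
  fixes F :: "(real \<Rightarrow> real) \<Rightarrow> real"
  assumes F: "F \<in> borel_measurable path_borel" and bound: "\<And>f. \<bar>F f\<bar> \<le> B"
    and t: "0 < t" "t < 1" and a: "0 \<le> a" "a \<le> t" and \<sigma>: "\<bar>\<sigma>\<bar> = 1"
  defines "E \<equiv> {w \<in> space M. (\<exists>s\<in>{a..t}. X s w = 0) \<and> (\<forall>s\<in>{t..1}. 0 < \<sigma> * X s w)}"
  shows "E \<in> events"
    and "(\<integral>w. indicator E w * F (path_reversal (path_of (\<lambda>s w. \<bar>X (t + s * (1 - t)) w\<bar> / sqrt (1 - t)) w)) \<partial>M)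
      = (\<integral>w. indicator E w * (\<integral>f. F f \<partial>conditioned_law M X (\<bar>X t w\<bar> / sqrt (1 - t))) \<partial>M)"
proof -
  \<comment> \<open>The sign is absorbed into the scaling factor, so that on \<open>E\<close> the
    rescaled |X| over [t,1] is \<open>c * X\<close>.\<close>
  define c where "c = \<sigma> / sqrt (1 - t)"
  let ?P = "path_of (\<lambda>s. X (t * s))"
  let ?Z = "path_of (\<lambda>s w. c * (X (t + (1 - t) * s) w - X t w))"
  let ?L = "\<lambda>y. \<integral>f. F f \<partial>conditioned_law M X y"
  have c: "\<bar>c\<bar> * sqrt (1 - t) = 1" using t \<sigma> by (simp add: c_def abs_divide)
  have \<sigma>c: "0 < \<sigma> * x \<longleftrightarrow> 0 < c * x" for x
    using t by (simp add: c_def zero_less_divide_iff)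
  have abs_c: "\<bar>x\<bar> / sqrt (1 - t) = c * x" if "0 < c * x" for x
  proof -
    have "\<bar>x\<bar> / sqrt (1 - t) = \<bar>c * x\<bar>" using \<sigma> t by (simp add: c_def abs_mult abs_divide)
    then show ?thesis using that by simp
  qed
  have "0 \<le> B" using bound[of undefined] by linarith
  have in_rest: "t + (1 - t) * s \<in> {t..1}" if "s \<in> {0..1}" for s
  proof -
    have "(1 - t) * s \<le> 1 - t" using that t by (intro mult_left_le) auto
    moreover have "0 \<le> (1 - t) * s" using that t by simp
    ultimately show ?thesis unfolding atLeastAtMost_iff by linarith
  qed
  interpret Z: unit_brownian_motion M "\<lambda>s w. c * (X (t + (1 - t) * s) w - X t w)"
    using t c by (intro unit_brownian_rescaled) auto
  have law_Z: "distr M path_borel ?Z = reversed_law"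
    by (rule unit_brownian_law_unique[OF Z.unit_brownian_motion_axioms unit_brownian_reversed])
  note ind = indep_past_future[OF t, of c]
  have mP: "?P \<in> M \<rightarrow>\<^sub>M path_borel" using ind by (rule indep_var_rv1)
  have joint: "distr M path_borel ?P \<Otimes>\<^sub>M reversed_law = distr M (path_borel \<Otimes>\<^sub>M path_borel) (\<lambda>w. (?P w, ?Z w))"
    using ind unfolding indep_var_distribution_eq law_Z by blast
  have mPZ: "(\<lambda>w. (?P w, ?Z w)) \<in> M \<rightarrow>\<^sub>M path_borel \<Otimes>\<^sub>M path_borel"
    using mP Z.measurable_path by (rule measurable_Pair)
  interpret LP: prob_space "distr M path_borel ?P" by (rule prob_space_distr[OF mP])
  interpret R: prob_space reversed_law by (rule prob_space_reversed_law)
  interpret PR: pair_prob_space "distr M path_borel ?P" reversed_law ..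
  \<comment> \<open>\<open>?P\<close> runs through [0,t] with time rescaled to [0,1], which turns
    [a,t] into [a/t,1].\<close>
  define A where "A = {p \<in> space path_borel. \<exists>s\<in>{a / t..1}. p s = 0}"
  have A_sets: "A \<in> sets path_borel"
    unfolding A_def
  proof (rule sets_has_zero_on_compact)
    have "{a / t..1} \<subseteq> {0..1}" using a t by auto
    then show "continuous_on {a / t..1} (\<lambda>s. p s)" if "p \<in> space path_borel" for p
      using that space_path_borel continuous_on_subset by blast
    show "(\<lambda>p. p s) \<in> borel_measurable path_borel" if "s \<in> {a / t..1}" for s
      using that \<open>{a / t..1} \<subseteq> {0..1}\<close> by (intro measurable_eval) auto
  qed simp
  have m1: "(\<lambda>p. c * p 1) \<in> borel_measurable path_borel"
    by (intro borel_measurable_times measurable_eval) auto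
  \<comment> \<open>\<open>fst q 1\<close> is the value of \<open>X\<close> at time
    \<open>t\<close>, so \<open>c * fst q 1\<close> is a level known from the past, and only the
    increments in \<open>snd q\<close> come from the future.\<close>
  define Q where "Q = {q \<in> space (path_borel \<Otimes>\<^sub>M path_borel). fst q \<in> A \<and> snd q \<in> paths_above (c * fst q 1)}"
  have Q_sets: "Q \<in> sets (path_borel \<Otimes>\<^sub>M path_borel)"
  proof -
    have "{p \<in> space path_borel. p \<in> A} = A" by (auto simp: A_def)
    then have "{q \<in> space (path_borel \<Otimes>\<^sub>M path_borel). fst q \<in> A} \<in> sets (path_borel \<Otimes>\<^sub>M path_borel)"
      using A_sets by (intro measurable_sets_Collect[OF measurable_fst]) simp
    then show ?thesis
      unfolding Q_def using sets_above_pair[OF m1] by (intro sets.sets_Collect_conj)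
  qed
  have EQ: "w \<in> E \<longleftrightarrow> (?P w, ?Z w) \<in> Q" if w: "w \<in> space M" for w
  proof -
    have P_eq: "?P w s = X (t * s) w" if "s \<in> {a / t..1}" for s
      using that a t order_trans[of 0 "a / t" s] by simp
    have "?P w \<in> A \<longleftrightarrow> (\<exists>s\<in>{a / t..1}. ?P w s = 0)"
      using measurable_space[OF mP w] unfolding A_def by blast
    also have "\<dots> \<longleftrightarrow> (\<exists>s\<in>{a / t..1}. X (t * s) w = 0)"
      by (rule bex_cong[OF refl]) (simp only: P_eq)
    also have "\<dots> \<longleftrightarrow> (\<exists>s\<in>{a..t}. X s w = 0)"
    proof
      assume "\<exists>s\<in>{a / t..1}. X (t * s) w = 0"
      then obtain s where "s \<in> {a / t..1}" "X (t * s) w = 0" by blast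
      then show "\<exists>s\<in>{a..t}. X s w = 0" using t by (intro bexI[of _ "t * s"]) (auto simp: field_simps)
    next
      assume "\<exists>s\<in>{a..t}. X s w = 0"
      then obtain s where "s \<in> {a..t}" "X s w = 0" by blast
      then show "\<exists>s\<in>{a / t..1}. X (t * s) w = 0" using t by (intro bexI[of _ "s / t"]) (auto simp: field_simps)
    qed
    finally have 1: "?P w \<in> A \<longleftrightarrow> (\<exists>s\<in>{a..t}. X s w = 0)" .
    have "?Z w \<in> paths_above (c * ?P w 1) \<longleftrightarrow> (\<forall>s\<in>{0..1}. 0 < \<sigma> * X (t + (1 - t) * s) w)"
      using measurable_space[OF Z.measurable_path w] by (auto simp: paths_above_def \<sigma>c algebra_simps)
    also have "\<dots> \<longleftrightarrow> (\<forall>s\<in>{t..1}. 0 < \<sigma> * X s w)"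
    proof
      assume L: "\<forall>s\<in>{0..1}. 0 < \<sigma> * X (t + (1 - t) * s) w"
      show "\<forall>s\<in>{t..1}. 0 < \<sigma> * X s w"
      proof
        fix s assume "s \<in> {t..1}"
        then have "(s - t) / (1 - t) \<in> {0..1}" "t + (1 - t) * ((s - t) / (1 - t)) = s"
          using t by (auto simp: divide_le_eq_1)
        then show "0 < \<sigma> * X s w" using L by metis
      qed
    next
      assume R: "\<forall>s\<in>{t..1}. 0 < \<sigma> * X s w"
      show "\<forall>s\<in>{0..1}. 0 < \<sigma> * X (t + (1 - t) * s) w"
      proof
        fix s :: real assume "s \<in> {0..1}"
        then show "0 < \<sigma> * X (t + (1 - t) * s) w" using R in_rest by blast
      qed
    qed
    finally show ?thesis
      using 1 w measurable_space[OF mPZ w] by (auto simp: E_def Q_def space_pair_measure)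
  qed
  then have E_eq: "E = (\<lambda>w. (?P w, ?Z w)) -` Q \<inter> space M" by (auto simp: E_def)
  show "E \<in> events" unfolding E_eq by (rule measurable_sets[OF mPZ Q_sets])
  have Q_ind: "indicator Q (p, z) = (indicator A p * indicator (paths_above (c * p 1)) z :: real)"
    if "p \<in> space path_borel" "z \<in> space path_borel" for p z
    using that by (auto simp: Q_def indicator_def space_pair_measure)
  \<comment> \<open>On \<open>E\<close> the rescaled |X| is \<open>?Z\<close> plus the constant c *
    X t, and the reversal cancels constants.\<close>
  have on_E: "path_reversal (path_of (\<lambda>s w. \<bar>X (t + s * (1 - t)) w\<bar> / sqrt (1 - t)) w) = path_reversal (?Z w)"
    "\<bar>X t w\<bar> / sqrt (1 - t) = c * ?P w 1" if w: "w \<in> E" for w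
  proof -
    have pos: "0 < c * X s w" if "s \<in> {t..1}" for s using w that by (auto simp: E_def \<sigma>c)
    then show "\<bar>X t w\<bar> / sqrt (1 - t) = c * ?P w 1" using abs_c t by simp
    have val: "\<bar>X (t + s * (1 - t)) w\<bar> / sqrt (1 - t) = c * X (t + (1 - t) * s) w" if "s \<in> {0..1}" for s
    proof -
      show ?thesis using abs_c[OF pos[OF in_rest[OF that]]] by (simp add: mult.commute)
    qed
    show "path_reversal (path_of (\<lambda>s w. \<bar>X (t + s * (1 - t)) w\<bar> / sqrt (1 - t)) w) = path_reversal (?Z w)"
      unfolding path_reversal_def
    proof (rule restrict_ext)
      fix s :: real assume "s \<in> {0..1}"
      then have s: "1 - s \<in> {0..1}" by simp
      show "path_of (\<lambda>s w. \<bar>X (t + s * (1 - t)) w\<bar> / sqrt (1 - t)) w 1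
          - path_of (\<lambda>s w. \<bar>X (t + s * (1 - t)) w\<bar> / sqrt (1 - t)) w (1 - s) = ?Z w 1 - ?Z w (1 - s)"
        using val[of 1] val[OF s] s by (simp add: right_diff_distrib)
    qed
  qed
  have mL: "?L \<in> borel_measurable borel" by (rule measurable_integral_conditioned_law[OF F])
  \<comment> \<open>Fubini for the independent pair. It is used once to freeze the past and once,
    read backwards, to return to \<open>M\<close> after \<open>F\<close> has been averaged.\<close>
  have transfer: "(\<integral>w. indicator Q (?P w, ?Z w) * h (?P w) (?Z w) \<partial>M)
      = (\<integral>p. (\<integral>z. indicator Q (p, z) * h p z \<partial>reversed_law) \<partial>distr M path_borel ?P)"
    if h: "(\<lambda>q. h (fst q) (snd q)) \<in> borel_measurable (path_borel \<Otimes>\<^sub>M path_borel)" "\<And>p z. \<bar>h p z\<bar> \<le> B"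
    for h :: "(real \<Rightarrow> real) \<Rightarrow> (real \<Rightarrow> real) \<Rightarrow> real"
  proof -
    let ?g = "\<lambda>q. indicator Q q * h (fst q) (snd q)"
    have mg: "?g \<in> borel_measurable (path_borel \<Otimes>\<^sub>M path_borel)"
      using h Q_sets by (intro borel_measurable_times borel_measurable_indicator)
    have sets_eq: "sets (distr M path_borel ?P \<Otimes>\<^sub>M reversed_law) = sets (path_borel \<Otimes>\<^sub>M path_borel)"
      by (intro sets_pair_measure_cong) auto
    have "integrable (distr M path_borel ?P \<Otimes>\<^sub>M reversed_law) ?g"
    proof (rule PR.integrable_const_bound[where B = B])
      show "?g \<in> borel_measurable (distr M path_borel ?P \<Otimes>\<^sub>M reversed_law)"
        using mg by (simp cong: measurable_cong_sets[OF sets_eq refl])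
      show "AE q in distr M path_borel ?P \<Otimes>\<^sub>M reversed_law. norm (?g q) \<le> B"
        using h(2) \<open>0 \<le> B\<close> by (auto simp: indicator_def)
    qed
    from PR.integral_fst'[OF this]
    have "(\<integral>p. (\<integral>z. indicator Q (p, z) * h p z \<partial>reversed_law) \<partial>distr M path_borel ?P)
        = integral\<^sup>L (distr M (path_borel \<Otimes>\<^sub>M path_borel) (\<lambda>w. (?P w, ?Z w))) ?g"
      by (simp add: joint)
    also have "\<dots> = (\<integral>w. ?g (?P w, ?Z w) \<partial>M)"
      by (rule integral_distr[OF mPZ mg])
    finally show ?thesis by simp
  qed
  have "(\<integral>w. indicator E w * F (path_reversal (path_of (\<lambda>s w. \<bar>X (t + s * (1 - t)) w\<bar> / sqrt (1 - t)) w)) \<partial>M)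
      = (\<integral>w. indicator Q (?P w, ?Z w) * F (path_reversal (?Z w)) \<partial>M)"
    by (intro Bochner_Integration.integral_cong refl) (use EQ on_E in \<open>auto simp: indicator_def\<close>)
  also have "\<dots> = (\<integral>p. (\<integral>z. indicator Q (p, z) * F (path_reversal z) \<partial>reversed_law) \<partial>distr M path_borel ?P)"
    by (rule transfer[of "\<lambda>p z. F (path_reversal z)"])
      (use bound measurable_compose[OF measurable_snd measurable_compose[OF measurable_path_reversal F]] in auto)
  \<comment> \<open>For a fixed past \<open>p\<close> the level is constant, so
    \<open>integral_above_eq\<close> replaces \<open>F\<close> by its conditioned mean times a
    survival probability. Writing that probability as the integral of an indicator restores the
    event \<open>Q\<close>.\<close>
  also have "\<dots> = (\<integral>p. (\<integral>z. indicator Q (p, z) * ?L (c * p 1) \<partial>reversed_law) \<partial>distr M path_borel ?P)"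
  proof (rule Bochner_Integration.integral_cong[OF refl])
    fix p assume "p \<in> space (distr M path_borel ?P)"
    then have p: "p \<in> space path_borel" by simp
    have "(\<integral>z. indicator Q (p, z) * F (path_reversal z) \<partial>reversed_law)
        = (\<integral>z. indicator A p * (indicator (paths_above (c * p 1)) z * F (path_reversal z)) \<partial>reversed_law)"
      by (intro Bochner_Integration.integral_cong refl) (use Q_ind[OF p] in auto)
    also have "\<dots> = indicator A p * (measure reversed_law (paths_above (c * p 1)) * ?L (c * p 1))"
      by (simp add: integral_above_eq[OF F bound])
    also have "\<dots> = (\<integral>z. indicator A p * ?L (c * p 1) * indicator (paths_above (c * p 1)) z \<partial>reversed_law)"
      using sets_paths_above by simp
    also have "\<dots> = (\<integral>z. indicator Q (p, z) * ?L (c * p 1) \<partial>reversed_law)"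
      by (intro Bochner_Integration.integral_cong refl) (use Q_ind[OF p] in auto)
    finally show "(\<integral>z. indicator Q (p, z) * F (path_reversal z) \<partial>reversed_law)
        = (\<integral>z. indicator Q (p, z) * ?L (c * p 1) \<partial>reversed_law)" .
  qed
  also have "\<dots> = (\<integral>w. indicator Q (?P w, ?Z w) * ?L (c * ?P w 1) \<partial>M)"
    by (rule transfer[of "\<lambda>p z. ?L (c * p 1)", symmetric])
      (use abs_integral_conditioned_law_le[OF F bound]
         measurable_compose[OF measurable_fst measurable_compose[OF m1 mL]] in auto)
  also have "\<dots> = (\<integral>w. indicator E w * ?L (\<bar>X t w\<bar> / sqrt (1 - t)) \<partial>M)"
    by (intro Bochner_Integration.integral_cong refl) (use EQ on_E in \<open>auto simp: indicator_def\<close>)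
  finally show "(\<integral>w. indicator E w * F (path_reversal (path_of (\<lambda>s w. \<bar>X (t + s * (1 - t)) w\<bar> / sqrt (1 - t)) w)) \<partial>M)
      = (\<integral>w. indicator E w * ?L (\<bar>X t w\<bar> / sqrt (1 - t)) \<partial>M)" .
qed

end

section \<open>The last zero before time 1 and its approximation by grid points\<close>

lemma tendsto_grid_approx:
  assumes "0 \<le> (h::real)"
  shows "(\<lambda>n. real (nat \<lfloor>h * real n\<rfloor>) / real n) \<longlonglongrightarrow> h"
proof (rule tendsto_sandwich[of "\<lambda>n. h - 1 / real n" _ _ "\<lambda>_. h"])
  show "\<forall>\<^sub>F n in sequentially. h - 1 / real n \<le> real (nat \<lfloor>h * real n\<rfloor>) / real n"
    using eventually_gt_at_top[of 0]
  proof eventually_elim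
    case (elim n)
    have "h * real n - 1 \<le> real (nat \<lfloor>h * real n\<rfloor>)" using assms by linarith
    then have "(h * real n - 1) / real n \<le> real (nat \<lfloor>h * real n\<rfloor>) / real n"
      by (rule divide_right_mono) simp
    then show ?case using elim by (simp add: diff_divide_distrib)
  qed
  show "\<forall>\<^sub>F n in sequentially. real (nat \<lfloor>h * real n\<rfloor>) / real n \<le> h"
    using eventually_gt_at_top[of 0]
  proof eventually_elim
    case (elim n)
    have "real (nat \<lfloor>h * real n\<rfloor>) \<le> h * real n" using assms by simp
    then show ?case using elim by (simp add: divide_le_eq)
  qed
  show "(\<lambda>n. h - 1 / real n) \<longlonglongrightarrow> h"
    using tendsto_diff[OF tendsto_const lim_1_over_n, of h] by simp
qed simp

lemma constant_sign_of_nonzero: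
  fixes f :: "real \<Rightarrow> real"
  assumes "a \<le> b" "continuous_on {a..b} f" "\<And>s. s \<in> {a..b} \<Longrightarrow> f s \<noteq> 0"
  shows "(\<forall>s\<in>{a..b}. 0 < f s) \<or> (\<forall>s\<in>{a..b}. f s < 0)"
proof -
  have "connected (f ` {a..b})"
    using assms by (intro connected_continuous_image) auto
  moreover have "0 \<notin> f ` {a..b}" using assms(3) by force
  ultimately have "\<not> (x < 0 \<and> 0 < y)" if "x \<in> f ` {a..b}" "y \<in> f ` {a..b}" for x y
    using connectedD_interval[of "f ` {a..b}" x y 0] that by fastforce
  then show ?thesis
    using assms(3) by (meson imageI linorder_neqE_linordered_idom)
qed

context standard_brownian_motion
begin

text \<open>Holds because the law of \<open>X 1\<close> has a density. Off this null event the last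
  zero is attained and lies strictly before 1.\<close>

lemma AE_X_1_nonzero: "AE w in M. X 1 w \<noteq> 0"
proof -
  have D: "distributed M lborel (\<lambda>w. X 1 w - X 0 w) (normal_density 0 (sqrt (1 - 0)))"
    by (rule gaussian_increments) auto
  have "AE x in density lborel (\<lambda>x. ennreal (normal_density 0 (sqrt (1 - 0)) x)). x \<noteq> 0"
    using AE_lborel_singleton[of "0::real"] by (auto simp: AE_density elim!: eventually_mono)
  then have "AE x in distr M lborel (\<lambda>w. X 1 w - X 0 w). x \<noteq> 0"
    using D unfolding distributed_def by presburger
  then have "AE w in M. X 1 w - X 0 w \<noteq> 0"
    using D by (intro AE_distrD[of "\<lambda>w. X 1 w - X 0 w" M lborel]) (auto simp: distributed_def)
  then show ?thesis
    using AE_space by eventually_elim (simp add: starts_at_0)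
qed

text \<open>Rounding \<open>h\<close> down to a grid leaves countably many times, where
  measurability is clear; path continuity then passes to the limit.\<close>

lemma measurable_at_random_time:
  assumes h: "h \<in> borel_measurable M" and nonneg: "\<And>w. w \<in> space M \<Longrightarrow> 0 \<le> h w"
  shows "(\<lambda>w. X (h w) w) \<in> borel_measurable M"
proof (rule borel_measurable_LIMSEQ_real)
  let ?k = "\<lambda>n w. nat \<lfloor>h w * real n\<rfloor>"
  show "(\<lambda>n. X (real (?k n w) / real n) w) \<longlonglongrightarrow> X (h w) w" if w: "w \<in> space M" for w
    by (rule continuous_on_tendsto_compose[OF continuous_paths[OF w] tendsto_grid_approx])
      (use nonneg w in auto)
  have "?k n \<in> M \<rightarrow>\<^sub>M count_space UNIV" for n
    using h by measurable
  then show "(\<lambda>w. X (real (?k n w) / real n) w) \<in> borel_measurable M" for n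
    by (rule measurable_compose_countable[where f = "\<lambda>i w. X (real i / real n) w", rotated])
      (auto intro: measurable_BM)
qed

abbreviation g :: "'w \<Rightarrow> real" where
  "g \<equiv> last_zero X 1"

lemma last_zero_set:
  assumes "w \<in> space M"
  defines "Z \<equiv> {s. 0 \<le> s \<and> s < 1 \<and> X s w = 0}"
  shows "g w = Sup Z" "0 \<in> Z" "bdd_above Z"
  using starts_at_0[OF assms(1)] by (auto simp: last_zero_def Z_def intro!: bdd_aboveI[of _ 1])

lemma last_zero_bounds:
  assumes "w \<in> space M"
  shows "0 \<le> g w \<and> g w \<le> 1"
  unfolding last_zero_set(1)[OF assms]
proof
  show "0 \<le> Sup {s. 0 \<le> s \<and> s < 1 \<and> X s w = 0}"
    by (rule cSup_upper[OF last_zero_set(2,3)[OF assms]])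
  show "Sup {s. 0 \<le> s \<and> s < 1 \<and> X s w = 0} \<le> 1"
    by (rule cSup_least) (use last_zero_set(2)[OF assms] in blast, simp)
qed

text \<open>The event a < g means a zero in [0,1) beyond a. This range is exhausted by the compact
  intervals \<open>?I m\<close>, on which \<open>sets_has_zero_on_compact\<close> applies.\<close>

lemma measurable_last_zero: "g \<in> borel_measurable M"
  unfolding borel_measurable_iff_greater
proof
  fix a
  let ?I = "\<lambda>m::nat. {max 0 (a + 1 / real (Suc m))..1 - 1 / real (Suc m)}"
  have "a < g w \<longleftrightarrow> (\<exists>m. \<exists>s\<in>?I m. X s w = 0)" if w: "w \<in> space M" for w
  proof -
    have "{s. 0 \<le> s \<and> s < 1 \<and> X s w = 0} \<noteq> {}" using last_zero_set(2)[OF w] by blast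
    from less_cSup_iff[OF this last_zero_set(3)[OF w], of a]
    have "a < g w \<longleftrightarrow> (\<exists>s. 0 \<le> s \<and> s < 1 \<and> X s w = 0 \<and> a < s)"
      unfolding last_zero_set(1)[OF w] by auto
    also have "\<dots> \<longleftrightarrow> (\<exists>m. \<exists>s\<in>?I m. X s w = 0)"
    proof
      assume "\<exists>s. 0 \<le> s \<and> s < 1 \<and> X s w = 0 \<and> a < s"
      then obtain s where s: "0 \<le> s" "s < 1" "X s w = 0" "a < s" by blast
      then obtain m where "1 / real (Suc m) < min (s - a) (1 - s)"
        using reals_Archimedean[of "min (s - a) (1 - s)"] by (auto simp: inverse_eq_divide)
      then have "s \<in> ?I m" using s by (simp add: min_less_iff_conj del: of_nat_Suc)
      then show "\<exists>m. \<exists>s\<in>?I m. X s w = 0" using s by blast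
    next
      assume "\<exists>m. \<exists>s\<in>?I m. X s w = 0"
      then obtain m s where s: "s \<in> ?I m" "X s w = 0" by blast
      have "0 < 1 / real (Suc m)" by simp
      moreover have "0 \<le> s" "a + 1 / real (Suc m) \<le> s" "s \<le> 1 - 1 / real (Suc m)"
        using s(1) by (simp_all del: of_nat_Suc)
      ultimately have "0 \<le> s" "s < 1" "a < s" by linarith+
      then show "\<exists>s. 0 \<le> s \<and> s < 1 \<and> X s w = 0 \<and> a < s" using s by blast
    qed
    finally show ?thesis .
  qed
  then have "{w \<in> space M. a < g w} = {w \<in> space M. \<exists>m. \<exists>s\<in>?I m. X s w = 0}" by auto
  also have "\<dots> \<in> events"
    by (intro sets.sets_Collect_countable_Ex sets_has_zero_on_compact continuous_X measurable_BM) auto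
  finally show "{w \<in> space M. a < g w} \<in> events" .
qed

text \<open>If \<open>X 1\<close> is nonzero, adding the endpoint 1 creates no new zero, so the zero
  set is closed and contains its supremum.\<close>

lemma last_zero_properties:
  assumes w: "w \<in> space M" and X1: "X 1 w \<noteq> 0"
  shows "0 \<le> g w" "g w < 1" "X (g w) w = 0" "\<And>s. g w < s \<Longrightarrow> s \<le> 1 \<Longrightarrow> X s w \<noteq> 0"
proof -
  let ?Z = "{s. 0 \<le> s \<and> s < 1 \<and> X s w = 0}"
  have eq: "?Z = {s \<in> {0..1}. X s w = 0}" using X1 by (auto simp: order_less_le)
  have "closed {s \<in> {0..1}. X s w = 0}"
    by (rule continuous_closed_preimage_constant[OF continuous_X[OF w]]) auto
  then have "closed ?Z" unfolding eq .
  moreover have "?Z \<noteq> {}" using last_zero_set(2)[OF w] by blast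
  ultimately have "Sup ?Z \<in> ?Z"
    using last_zero_set(3)[OF w] by (intro closed_contains_Sup)
  then show "0 \<le> g w" "g w < 1" "X (g w) w = 0" unfolding last_zero_set(1)[OF w] by auto
  fix s assume s: "g w < s" "s \<le> 1"
  show "X s w \<noteq> 0"
  proof
    assume "X s w = 0"
    then have "s \<in> ?Z" using s \<open>0 \<le> g w\<close> X1 by (auto simp: order_less_le)
    then have "s \<le> g w" unfolding last_zero_set(1)[OF w] by (rule cSup_upper[OF _ last_zero_set(3)[OF w]])
    then show False using s by simp
  qed
qed

abbreviation rescaled_after :: "real \<Rightarrow> 'w \<Rightarrow> real \<Rightarrow> real" where
  "rescaled_after t \<equiv> path_of (\<lambda>s w. \<bar>X (t + s * (1 - t)) w\<bar> / sqrt (1 - t))"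

abbreviation meander_path :: "'w \<Rightarrow> real \<Rightarrow> real" where
  "meander_path \<equiv> \<lambda>w. rescaled_after (g w) w"

lemma continuous_rescaled:
  assumes "w \<in> space M" "0 \<le> t" "t \<le> 1"
  shows "continuous_on {0..1} (\<lambda>s. \<bar>X (t + s * (1 - t)) w\<bar> / sqrt (1 - t))"
proof -
  have "0 \<le> t + s * (1 - t)" if "s \<in> {0..1}" for s using that assms by simp
  then have "continuous_on {0..1} (\<lambda>s. X (t + s * (1 - t)) w)"
    using assms(1) by (intro continuous_X_compose continuous_intros) auto
  then show ?thesis
    unfolding divide_inverse by (intro continuous_on_mult_right continuous_on_rabs)
qed

lemma measurable_rescaled:
  assumes h: "h \<in> borel_measurable M" and h01: "\<And>w. w \<in> space M \<Longrightarrow> 0 \<le> h w \<and> h w \<le> 1"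
  shows "(\<lambda>w. rescaled_after (h w) w) \<in> M \<rightarrow>\<^sub>M path_borel"
proof (rule measurable_path_of[of _ "\<lambda>s w. \<bar>X (h w + s * (1 - h w)) w\<bar> / sqrt (1 - h w)"])
  show "continuous_on {0..1} (\<lambda>s. \<bar>X (h w + s * (1 - h w)) w\<bar> / sqrt (1 - h w))" if "w \<in> space M" for w
    using h01 that by (intro continuous_rescaled) auto
  fix t :: real assume "t \<in> {0..1}"
  then have "(\<lambda>w. X (h w + t * (1 - h w)) w) \<in> borel_measurable M"
    using h h01 by (intro measurable_at_random_time) auto
  then show "(\<lambda>w. \<bar>X (h w + t * (1 - h w)) w\<bar> / sqrt (1 - h w)) \<in> borel_measurable M"
    using h by measurable
qed

text \<open>If \<open>X\<^sub>1 \<noteq> 0\<close>: the last zero lies in \<open>[k/N, (k+1)/N)\<close> and \<open>X\<^sub>1\<close> has sign \<open>\<sigma>\<close>.  The closed interval keeps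
  the condition on the past measurable up to time \<open>(k+1)/N\<close>.\<close>

definition last_zero_cell :: "nat \<Rightarrow> nat \<Rightarrow> real \<Rightarrow> 'w set" where
  "last_zero_cell N k \<sigma> = {w \<in> space M. (\<exists>s\<in>{real k / real N..real (Suc k) / real N}. X s w = 0) \<and>
     (\<forall>s\<in>{real (Suc k) / real N..1}. 0 < \<sigma> * X s w)}"

text \<open>Off the event X 1 = 0 the cells with both signs form a partition. A zero at a common
  endpoint is not counted twice, because the sign condition begins at the right endpoint and
  excludes a zero there. Beyond the last zero the sign is constant by connectedness.\<close>

lemma last_zero_cell_iff:
  assumes w: "w \<in> space M" and X1: "X 1 w \<noteq> 0" and k: "Suc k \<le> N"
  shows "indicator (last_zero_cell N k 1) w + indicator (last_zero_cell N k (-1)) w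
    = (if k = nat \<lfloor>g w * real N\<rfloor> then 1 else (0::real))"
proof -
  note g = last_zero_properties[OF w X1]
  let ?t = "real (Suc k) / real N"
  have t1: "?t \<le> 1" using k by (simp add: divide_le_eq_1)
  have "k = nat \<lfloor>g w * real N\<rfloor> \<longleftrightarrow> real k \<le> g w * real N \<and> g w * real N < real (Suc k)"
  proof
    assume "real k \<le> g w * real N \<and> g w * real N < real (Suc k)"
    then have "\<lfloor>g w * real N\<rfloor> = int k" by (intro floor_unique) auto
    then show "k = nat \<lfloor>g w * real N\<rfloor>" by simp
  next
    assume k_def: "k = nat \<lfloor>g w * real N\<rfloor>"
    have "0 \<le> g w * real N" using g(1) by simp
    then have "int k = \<lfloor>g w * real N\<rfloor>" unfolding k_def by simp
    then show "real k \<le> g w * real N \<and> g w * real N < real (Suc k)" by linarith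
  qed
  also have "\<dots> \<longleftrightarrow> real k / real N \<le> g w \<and> g w < ?t"
    using k by (auto simp: divide_le_eq less_divide_eq)
  finally have k_iff: "k = nat \<lfloor>g w * real N\<rfloor> \<longleftrightarrow> real k / real N \<le> g w \<and> g w < ?t" .
  have cell: "w \<in> last_zero_cell N k \<sigma> \<longleftrightarrow> k = nat \<lfloor>g w * real N\<rfloor> \<and> 0 < \<sigma> * X 1 w"
    if \<sigma>: "\<sigma> = 1 \<or> \<sigma> = -1" for \<sigma>
  proof
    assume L: "w \<in> last_zero_cell N k \<sigma>"
    then obtain s where s: "s \<in> {real k / real N..?t}" "X s w = 0" by (auto simp: last_zero_cell_def)
    have pos: "0 < \<sigma> * X s w" if "s \<in> {?t..1}" for s using L that unfolding last_zero_cell_def by blast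
    have "s \<le> g w" using g(4)[of s] s t1 by force
    then have "real k / real N \<le> g w" using s by auto
    moreover have "g w < ?t" using pos[of "g w"] g by force
    moreover have "0 < \<sigma> * X 1 w" using pos[of 1] t1 by simp
    ultimately show "k = nat \<lfloor>g w * real N\<rfloor> \<and> 0 < \<sigma> * X 1 w" using k_iff by blast
  next
    assume R: "k = nat \<lfloor>g w * real N\<rfloor> \<and> 0 < \<sigma> * X 1 w"
    then have gk: "real k / real N \<le> g w" "g w < ?t" using k_iff by auto
    have "0 \<le> ?t" by simp
    have "(\<forall>s\<in>{?t..1}. 0 < \<sigma> * X s w) \<or> (\<forall>s\<in>{?t..1}. \<sigma> * X s w < 0)"
    proof (rule constant_sign_of_nonzero[OF t1])
      show "continuous_on {?t..1} (\<lambda>s. \<sigma> * X s w)"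
        using w \<open>0 \<le> ?t\<close> by (intro continuous_on_mult_left continuous_X) auto
      show "\<sigma> * X s w \<noteq> 0" if "s \<in> {?t..1}" for s using that gk g(4)[of s] \<sigma> by auto
    qed
    moreover have "\<not> (\<forall>s\<in>{?t..1}. \<sigma> * X s w < 0)" using R t1 by force
    ultimately show "w \<in> last_zero_cell N k \<sigma>"
      using w gk g(3) unfolding last_zero_cell_def by auto
  qed
  show ?thesis
    using cell[of 1] cell[of "-1"] X1 by (auto simp: indicator_def)
qed

text \<open>For each N, summing \<open>excursion_conditioning\<close> over cells and signs equates
  two expectations, \<open>S U N\<close> and \<open>S V N\<close>. Dominated convergence sends the
  first to the meander and the second to \<open>l\<close>. Asking \<open>cont\<close> for pointwise
  convergence means that the rescaled paths need to converge only at each single time.\<close>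

lemma integral_meander:
  fixes F :: "(real \<Rightarrow> real) \<Rightarrow> real"
  assumes F: "F \<in> borel_measurable path_borel" and bound: "\<And>f. \<bar>F f\<bar> \<le> B"
    and cont: "\<And>u f. (\<And>s. s \<in> {0..1} \<Longrightarrow> (\<lambda>n. u n s) \<longlonglongrightarrow> f s) \<Longrightarrow> (\<lambda>n. F (u n)) \<longlonglongrightarrow> F f"
    and lim: "((\<lambda>y. \<integral>f. F f \<partial>conditioned_law M X y) \<longlongrightarrow> l) (at_right 0)"
  shows "(\<integral>w. F (path_reversal (meander_path w)) \<partial>M) = l"
proof -
  let ?L = "\<lambda>y. \<integral>f. F f \<partial>conditioned_law M X y"
  define t where "t N k = real (Suc k) / real N" for N k :: nat
  define U where "U N k w = F (path_reversal (rescaled_after (t N k) w))" for N k w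
  define V where "V N k w = ?L (\<bar>X (t N k) w\<bar> / sqrt (1 - t N k))" for N k w
  \<comment> \<open>The cell k = N - 1 is left out: its right end is 1, where the rescaling would
    divide by 0.\<close>
  define S where "S H N w = (\<Sum>k<N - 1. (indicator (last_zero_cell N k 1) w + indicator (last_zero_cell N k (-1)) w) * H N k w)"
    for H :: "nat \<Rightarrow> nat \<Rightarrow> 'w \<Rightarrow> real" and N w
  have "0 \<le> B" using bound[of undefined] by linarith
  have t01: "0 < t N k" "t N k < 1" if "k < N - 1" for N k
    using that by (auto simp: t_def divide_less_eq_1 zero_less_divide_iff)
  have mL: "?L \<in> borel_measurable borel" by (rule measurable_integral_conditioned_law[OF F])
  have boundL: "\<bar>?L y\<bar> \<le> B" for y by (rule abs_integral_conditioned_law_le[OF F bound])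
  have mU: "U N k \<in> borel_measurable M" if "k < N - 1" for N k
    unfolding U_def using t01[OF that]
    by (intro measurable_compose[OF measurable_compose[OF _ measurable_path_reversal] F] measurable_rescaled) auto
  have mV: "V N k \<in> borel_measurable M" if "k < N - 1" for N k
    unfolding V_def
  proof (rule measurable_compose[OF _ mL])
    have "X (t N k) \<in> borel_measurable M" using t01[OF that] by (intro measurable_BM) auto
    then show "(\<lambda>w. \<bar>X (t N k) w\<bar> / sqrt (1 - t N k)) \<in> borel_measurable M" by measurable
  qed
  have cell: "last_zero_cell N k \<sigma> \<in> events"
    "(\<integral>w. indicator (last_zero_cell N k \<sigma>) w * U N k w \<partial>M) = (\<integral>w. indicator (last_zero_cell N k \<sigma>) w * V N k w \<partial>M)"
    if "k < N - 1" "\<sigma> = 1 \<or> \<sigma> = -1" for N k \<sigma>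
  proof -
    have a: "0 \<le> real k / real N" "real k / real N \<le> t N k" by (auto simp: t_def divide_right_mono)
    have s: "\<bar>\<sigma>\<bar> = 1" using that(2) by auto
    show "last_zero_cell N k \<sigma> \<in> events"
      unfolding last_zero_cell_def t_def[symmetric]
      by (rule excursion_conditioning(1)[OF F bound t01[OF that(1)] a s])
    show "(\<integral>w. indicator (last_zero_cell N k \<sigma>) w * U N k w \<partial>M) = (\<integral>w. indicator (last_zero_cell N k \<sigma>) w * V N k w \<partial>M)"
      unfolding last_zero_cell_def t_def[symmetric] U_def V_def
      by (rule excursion_conditioning(2)[OF F bound t01[OF that(1)] a s])
  qed
  have S_integral: "(\<integral>w. S H N w \<partial>M) = (\<Sum>k<N - 1. (\<integral>w. indicator (last_zero_cell N k 1) w * H N k w \<partial>M)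
      + (\<integral>w. indicator (last_zero_cell N k (-1)) w * H N k w \<partial>M))"
    and S_meas: "S H N \<in> borel_measurable M"
    if H: "\<And>k. k < N - 1 \<Longrightarrow> H N k \<in> borel_measurable M" "\<And>k w. \<bar>H N k w\<bar> \<le> B" for H N
  proof -
    have "integrable M (\<lambda>w. indicator (last_zero_cell N k \<sigma>) w * H N k w)"
      if "k < N - 1" "\<sigma> = 1 \<or> \<sigma> = -1" for k \<sigma>
      using cell(1)[OF that] H(1)[OF that(1)] H(2) \<open>0 \<le> B\<close>
      by (intro integrable_const_bound[where B = B] borel_measurable_times borel_measurable_indicator)
        (auto simp: indicator_def)
    then show "(\<integral>w. S H N w \<partial>M) = (\<Sum>k<N - 1. (\<integral>w. indicator (last_zero_cell N k 1) w * H N k w \<partial>M)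
        + (\<integral>w. indicator (last_zero_cell N k (-1)) w * H N k w \<partial>M))"
      unfolding S_def distrib_right by (subst Bochner_Integration.integral_sum) auto
    show "S H N \<in> borel_measurable M"
      unfolding S_def
      by (intro borel_measurable_sum borel_measurable_times borel_measurable_add borel_measurable_indicator cell H(1)) auto
  qed
  have UV: "(\<integral>w. S U N w \<partial>M) = (\<integral>w. S V N w \<partial>M)" for N
  proof -
    have "\<bar>U N k w\<bar> \<le> B" "\<bar>V N k w\<bar> \<le> B" for k w
      using bound boundL by (auto simp: U_def V_def)
    then show ?thesis
      by (subst (1 2) S_integral) (use mU mV cell(2) in auto)
  qed
  define k where "k w N = nat \<lfloor>g w * real N\<rfloor>" for w N
  have S_eq: "S H N w = (if k w N < N - 1 then H N (k w N) w else 0)"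
    if w: "w \<in> space M" "X 1 w \<noteq> 0" for H N w
  proof -
    have "S H N w = (\<Sum>i<N - 1. (if i = k w N then H N i w else 0))"
      unfolding S_def using last_zero_cell_iff[OF w, of _ N] by (intro sum.cong) (auto simp: k_def)
    then show ?thesis by (simp add: sum.delta)
  qed
  \<comment> \<open>Once N exceeds 1/(1 - g), the last zero lies to the left of the omitted cell,
    and \<open>S\<close> reduces to the single summand of its own cell.\<close>
  have S_lim: "(\<lambda>N. S H N w) \<longlonglongrightarrow> z"
    if w: "w \<in> space M" "X 1 w \<noteq> 0" and H: "(\<lambda>N. H N (k w N) w) \<longlonglongrightarrow> z" for H w z
  proof (rule Lim_transform_eventually[OF H])
    note g = last_zero_properties[OF w]
    have "\<forall>\<^sub>F N in sequentially. 1 / (1 - g w) < real N"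
      using filterlim_real_sequentially by (simp add: filterlim_at_top_dense)
    then show "\<forall>\<^sub>F N in sequentially. H N (k w N) w = S H N w"
    proof eventually_elim
      case (elim N)
      then have "1 < (1 - g w) * real N" using g(2) by (simp add: divide_less_eq mult.commute)
      then have "g w * real N < real N - 1" by (simp add: algebra_simps)
      moreover have "0 \<le> g w * real N" using g(1) by simp
      then have "real (k w N) \<le> g w * real N" unfolding k_def by simp
      ultimately have "k w N < N - 1" by linarith
      then show ?case by (simp add: S_eq[OF w])
    qed
  qed
  have t_lim: "(\<lambda>N. t N (k w N)) \<longlonglongrightarrow> g w" if w: "w \<in> space M" "X 1 w \<noteq> 0" for w
    using tendsto_add[OF tendsto_grid_approx[OF last_zero_properties(1)[OF w]] lim_1_over_n]
    by (simp add: t_def k_def add_divide_distrib add.commute)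
  \<comment> \<open>Strictness matters: it makes \<open>X\<close> nonzero at the grid point, hence
    the level positive.\<close>
  have t_gt: "\<forall>\<^sub>F N in sequentially. g w < t N (k w N)" if w: "w \<in> space M" "X 1 w \<noteq> 0" for w
    using eventually_gt_at_top[of 0]
  proof eventually_elim
    case (elim N)
    have "g w * real N < real (Suc (k w N))"
      using last_zero_properties(1)[OF w] unfolding k_def by simp linarith
    then show ?case using elim by (simp add: t_def less_divide_eq)
  qed
  have X_lim: "(\<lambda>N. \<bar>X (t N (k w N) + s * (1 - t N (k w N))) w\<bar> / sqrt (1 - t N (k w N)))
      \<longlonglongrightarrow> \<bar>X (g w + s * (1 - g w)) w\<bar> / sqrt (1 - g w)"
    if w: "w \<in> space M" "X 1 w \<noteq> 0" and s: "s \<in> {0..1}" for w s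
  proof -
    note g = last_zero_properties[OF w]
    have "0 < g w + s * (1 - g w) \<or> s = 0 \<and> g w = 0" using g s by (auto simp: add_nonneg_eq_0_iff order_less_le)
    have pos: "\<forall>\<^sub>F N in sequentially. t N (k w N) + s * (1 - t N (k w N)) \<in> {0..}"
      using t_gt[OF w] order_tendstoD(2)[OF t_lim[OF w] g(2)]
      by eventually_elim (use g(1) s in auto)
    have "(\<lambda>N. X (t N (k w N) + s * (1 - t N (k w N))) w) \<longlonglongrightarrow> X (g w + s * (1 - g w)) w"
      by (rule continuous_on_tendsto_compose[OF continuous_paths[OF w(1)] _ _ pos])
        (use g s t_lim[OF w] in \<open>auto intro!: tendsto_intros\<close>)
    then show ?thesis
      using g(2) by (intro tendsto_intros t_lim w) auto
  qed
  have "(\<lambda>N. \<integral>w. S U N w \<partial>M) \<longlonglongrightarrow> (\<integral>w. F (path_reversal (meander_path w)) \<partial>M)"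
  proof (rule integral_dominated_convergence[where w = "\<lambda>_. B"])
    show "S U N \<in> borel_measurable M" for N
      by (rule S_meas) (use mU bound in \<open>auto simp: U_def\<close>)
    show "(\<lambda>w. F (path_reversal (meander_path w))) \<in> borel_measurable M"
      by (intro measurable_compose[OF measurable_compose[OF _ measurable_path_reversal] F]
          measurable_rescaled measurable_last_zero last_zero_bounds)
    show "AE w in M. (\<lambda>N. S U N w) \<longlonglongrightarrow> F (path_reversal (meander_path w))"
      using AE_X_1_nonzero AE_space
    proof eventually_elim
      case (elim w)
      show ?case
      proof (rule S_lim)
        show "(\<lambda>N. U N (k w N) w) \<longlonglongrightarrow> F (path_reversal (meander_path w))"
          unfolding U_def
        proof (rule cont)
          fix s :: real assume s: "s \<in> {0..1}"
          have "(\<lambda>N. rescaled_after (t N (k w N)) w r) \<longlonglongrightarrow> meander_path w r" if "r \<in> {0..1}" for r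
            using X_lim[OF elim(2,1) that] that by simp
          from tendsto_diff[OF this[of 1] this[of "1 - s"]] s
          show "(\<lambda>N. path_reversal (rescaled_after (t N (k w N)) w) s) \<longlonglongrightarrow> path_reversal (meander_path w) s"
            by (simp add: path_reversal_def)
        qed
      qed (use elim in auto)
    qed
    show "AE w in M. norm (S U N w) \<le> B" for N
      using AE_X_1_nonzero AE_space
      by eventually_elim (use bound \<open>0 \<le> B\<close> in \<open>auto simp: S_eq U_def\<close>)
  qed simp
  moreover have "(\<lambda>N. \<integral>w. S V N w \<partial>M) \<longlonglongrightarrow> (\<integral>w. l \<partial>M)"
  proof (rule integral_dominated_convergence[where w = "\<lambda>_. B"])
    show "S V N \<in> borel_measurable M" for N
      by (rule S_meas) (use mV boundL in \<open>auto simp: V_def\<close>)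
    show "AE w in M. (\<lambda>N. S V N w) \<longlonglongrightarrow> l"
      using AE_X_1_nonzero AE_space
    proof eventually_elim
      case (elim w)
      note w = elim(2,1) and g = last_zero_properties[OF elim(2,1)]
      show ?case
      proof (rule S_lim[OF w])
        \<comment> \<open>The level tends to 0 since \<open>X\<close> vanishes at \<open>g\<close>
          while 1 - g stays positive; it approaches from the right since no zero follows
          \<open>g\<close>.\<close>
        have "filterlim (\<lambda>N. \<bar>X (t N (k w N)) w\<bar> / sqrt (1 - t N (k w N))) (at_right 0) sequentially"
          unfolding filterlim_at
        proof
          show "\<forall>\<^sub>F N in sequentially. \<bar>X (t N (k w N)) w\<bar> / sqrt (1 - t N (k w N)) \<in> {0<..} \<and>
              \<bar>X (t N (k w N)) w\<bar> / sqrt (1 - t N (k w N)) \<noteq> 0"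
            using t_gt[OF w] order_tendstoD(2)[OF t_lim[OF w] g(2)]
            by eventually_elim (use g(4) in auto)
          show "(\<lambda>N. \<bar>X (t N (k w N)) w\<bar> / sqrt (1 - t N (k w N))) \<longlonglongrightarrow> 0"
            using X_lim[OF w, of 0] g(3) by simp
        qed
        from filterlim_compose[OF lim this]
        show "(\<lambda>N. V N (k w N) w) \<longlonglongrightarrow> l" unfolding V_def .
      qed
    qed
    show "AE w in M. norm (S V N w) \<le> B" for N
      using AE_X_1_nonzero AE_space
      by eventually_elim (use boundL \<open>0 \<le> B\<close> in \<open>auto simp: S_eq V_def\<close>)
  qed simp_all
  ultimately show ?thesis
    using LIMSEQ_unique unfolding UV by (simp add: prob_space) blast
qed

end

section \<open>From continuous test functionals to equality of laws\<close>

text \<open>For n > 0 each factor is 1 up to \<open>a\<close> and falls linearly to 0 at a + 1/n: a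
  continuous majorant of the indicator of the cylinder, bounded by 1.\<close>

definition ramp_product :: "nat \<Rightarrow> (real \<times> real) set \<Rightarrow> (real \<Rightarrow> real) \<Rightarrow> real" where
  "ramp_product n J f = (\<Prod>(s, a)\<in>J. max 0 (min 1 (1 - real n * (f s - a))))"

lemma ramp_product_bounds: "0 \<le> ramp_product n J f" "ramp_product n J f \<le> 1"
  unfolding ramp_product_def by (auto intro!: prod_nonneg prod_le_1 simp: split_beta)

lemma continuous_map_ramp_product:
  assumes "finite J" "J \<subseteq> {0..1} \<times> UNIV"
  shows "continuous_map path_topology euclideanreal (ramp_product n J)"
  using assms
proof (induction J rule: finite_induct)
  case (insert p J)
  have "continuous_map path_topology euclideanreal (\<lambda>f. max 0 (min 1 (1 - real n * (f (fst p) - snd p))))"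
    using insert.prems by (intro continuous_intros continuous_map_eval) auto
  then have "continuous_map path_topology euclideanreal
      (\<lambda>f. max 0 (min 1 (1 - real n * (f (fst p) - snd p))) * ramp_product n J f)"
    using insert by (intro continuous_map_real_mult) auto
  then show ?case
    using insert.hyps by (simp add: ramp_product_def[abs_def] split_beta)
qed (simp add: ramp_product_def[abs_def])

lemma measurable_ramp_product:
  assumes "finite J" "J \<subseteq> {0..1} \<times> UNIV"
  shows "ramp_product n J \<in> borel_measurable path_borel"
  unfolding ramp_product_def[abs_def] split_beta
  by (intro borel_measurable_prod borel_measurable_max borel_measurable_min borel_measurable_diff
      borel_measurable_times borel_measurable_const measurable_eval) (use assms in auto)

lemma tendsto_ramp_product:
  assumes J: "finite J" and f: "f \<in> space path_borel"
  shows "(\<lambda>n. ramp_product n J f) \<longlonglongrightarrow> indicator (cylinder J) f"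
proof -
  have "(\<lambda>n. max 0 (min 1 (1 - real n * (f s - a)))) \<longlonglongrightarrow> (if f s \<le> a then 1 else 0)" for s a
  proof (cases "f s \<le> a")
    case True
    then have "max 0 (min 1 (1 - real n * (f s - a))) = 1" for n
      using mult_nonneg_nonpos[of "real n" "f s - a"] by simp
    then show ?thesis using True by simp
  next
    case False
    have "\<forall>\<^sub>F n in sequentially. 1 / (f s - a) < real n"
      using filterlim_real_sequentially by (simp add: filterlim_at_top_dense)
    then have "\<forall>\<^sub>F n in sequentially. 0 = max 0 (min 1 (1 - real n * (f s - a)))"
      by eventually_elim (use False in \<open>simp add: divide_less_eq\<close>)
    then show ?thesis using False by (auto intro: Lim_transform_eventually[OF tendsto_const])
  qed
  then have "(\<lambda>n. ramp_product n J f) \<longlonglongrightarrow> (\<Prod>p\<in>J. if f (fst p) \<le> snd p then 1 else 0)"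
    unfolding ramp_product_def split_beta by (intro tendsto_prod)
  also have "(\<Prod>p\<in>J. if f (fst p) \<le> snd p then 1 else 0) = (indicator (cylinder J) f :: real)"
  proof (cases "f \<in> cylinder J")
    case True
    then have "f (fst p) \<le> snd p" if "p \<in> J" for p using that by (auto simp: cylinder_def)
    then show ?thesis using True by simp
  next
    case False
    then obtain p where "p \<in> J" "\<not> f (fst p) \<le> snd p" using f by (auto simp: cylinder_def)
    then show ?thesis using False J by (auto intro!: prod_zero bexI[of _ p])
  qed
  finally show ?thesis .
qed

text \<open>The ramps decrease exactly to the closed condition, boundary included, so cylinder
  probabilities are recovered without examining the mass on boundaries.\<close>

lemma tendsto_integral_ramp_product:
  assumes "prob_space \<mu>" "sets \<mu> = sets path_borel" "finite J" "J \<subseteq> {0..1} \<times> UNIV"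
  shows "(\<lambda>n. \<integral>f. ramp_product n J f \<partial>\<mu>) \<longlonglongrightarrow> measure \<mu> (cylinder J)"
proof -
  interpret prob_space \<mu> by fact
  have C: "cylinder J \<in> sets \<mu>"
    unfolding assms(2) using assms(3,4) by (intro cylinder_in_sigma measurable_eval) auto
  have "(\<lambda>n. \<integral>f. ramp_product n J f \<partial>\<mu>) \<longlonglongrightarrow> (\<integral>f. indicator (cylinder J) f \<partial>\<mu>)"
  proof (rule integral_dominated_convergence[where w = "\<lambda>_. 1"])
    show "ramp_product n J \<in> borel_measurable \<mu>" for n
      using measurable_ramp_product[OF assms(3,4)] by (simp cong: measurable_cong_sets[OF assms(2) refl])
    show "AE f in \<mu>. (\<lambda>n. ramp_product n J f) \<longlonglongrightarrow> indicator (cylinder J) f"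
      using tendsto_ramp_product[OF assms(3)] sets_eq_imp_space_eq[OF assms(2)] by auto
    show "AE f in \<mu>. norm (ramp_product n J f) \<le> 1" for n
      using ramp_product_bounds[of n J] by auto
  qed (use C in auto)
  then show ?thesis using C by simp
qed

theorem proposition6p1:
  fixes M :: "'w measure" and X :: "real \<Rightarrow> 'w \<Rightarrow> real"
    and N\<^sub>\<aa> :: "'a measure" and \<aa> :: "'a \<Rightarrow> real \<Rightarrow> real"
    and N\<^sub>\<mm> :: "'b measure" and \<mm> :: "'b \<Rightarrow> real \<Rightarrow> real"
  assumes "standard_brownian_motion M X"
    and "brownian_ascent M X N\<^sub>\<aa> \<aa>"
    and "brownian_meander M X N\<^sub>\<mm> \<mm>"
  shows "distr N\<^sub>\<aa> path_borel \<aa> =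
         distr N\<^sub>\<mm> path_borel (\<lambda>w. \<lambda>s\<in>{0..1}. \<mm> w 1 - \<mm> w (1 - s))"
proof -
  interpret standard_brownian_motion M X by fact
  interpret A: prob_space "N\<^sub>\<aa>" using assms(2) by (simp add: brownian_ascent_def)
  have ma: "\<aa> \<in> N\<^sub>\<aa> \<rightarrow>\<^sub>M path_borel"
    and conv: "weakly_converges path_topology (conditioned_law M X) (distr N\<^sub>\<aa> path_borel \<aa>) (at_right 0)"
    using assms(2) by (auto simp: brownian_ascent_def)
  have mm: "\<mm> \<in> N\<^sub>\<mm> \<rightarrow>\<^sub>M path_borel"
    and law: "distr N\<^sub>\<mm> path_borel \<mm> = distr M path_borel meander_path"
    using assms(3) by (auto simp: brownian_meander_def Let_def)
  have m_meander: "meander_path \<in> M \<rightarrow>\<^sub>M path_borel"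
    by (intro measurable_rescaled measurable_last_zero last_zero_bounds)
  have m_rev: "(\<lambda>w. path_reversal (meander_path w)) \<in> M \<rightarrow>\<^sub>M path_borel"
    by (rule measurable_compose[OF m_meander measurable_path_reversal])
  have "distr N\<^sub>\<mm> path_borel (\<lambda>w. path_reversal (\<mm> w)) = distr (distr N\<^sub>\<mm> path_borel \<mm>) path_borel path_reversal"
    using mm by (simp add: distr_distr[OF measurable_path_reversal] o_def)
  also have "\<dots> = distr M path_borel (\<lambda>w. path_reversal (meander_path w))"
    unfolding law using m_meander by (simp add: distr_distr[OF measurable_path_reversal] o_def)
  finally have rhs: "distr N\<^sub>\<mm> path_borel (\<lambda>w. path_reversal (\<mm> w))
      = distr M path_borel (\<lambda>w. path_reversal (meander_path w))" .
  have "distr N\<^sub>\<aa> path_borel \<aa> = distr M path_borel (\<lambda>w. path_reversal (meander_path w))" (is "?\<mu> = ?\<nu>")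
  proof (rule path_measure_eqI)
    show "prob_space ?\<mu>" by (rule A.prob_space_distr[OF ma])
    then interpret \<mu>: prob_space ?\<mu> .
    interpret \<nu>: prob_space ?\<nu> by (rule prob_space_distr[OF m_rev])
    fix J :: "(real \<times> real) set" assume J: "finite J" "J \<subseteq> (\<rat> \<inter> {0..1}) \<times> UNIV"
    then have J01: "J \<subseteq> {0..1} \<times> UNIV" by auto
    \<comment> \<open>The sharpness n stays fixed while y tends to 0: the definition of the ascent
      provides the limit, and \<open>integral_meander\<close> identifies it with the meander
      expectation. Only afterwards does n grow.\<close>
    have same: "(\<integral>f. ramp_product n J f \<partial>?\<mu>) = (\<integral>f. ramp_product n J f \<partial>?\<nu>)" for n
    proof -
      have m: "ramp_product n J \<in> borel_measurable path_borel"
        by (rule measurable_ramp_product[OF J(1) J01])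
      have "bounded (ramp_product n J ` topspace path_topology)"
        using ramp_product_bounds[of n J] by (intro boundedI[of _ 1]) auto
      then have "((\<lambda>y. \<integral>f. ramp_product n J f \<partial>conditioned_law M X y) \<longlongrightarrow> (\<integral>f. ramp_product n J f \<partial>?\<mu>)) (at_right 0)"
        using conv continuous_map_ramp_product[OF J(1) J01, of n] unfolding weakly_converges_def by blast
      then have "(\<integral>w. ramp_product n J (path_reversal (meander_path w)) \<partial>M) = (\<integral>f. ramp_product n J f \<partial>?\<mu>)"
      proof (rule integral_meander[OF m, rotated 2])
        show "\<bar>ramp_product n J f\<bar> \<le> 1" for f using ramp_product_bounds[of n J f] by simp
        show "(\<lambda>i. ramp_product n J (u i)) \<longlonglongrightarrow> ramp_product n J f"
          if "\<And>s. s \<in> {0..1} \<Longrightarrow> (\<lambda>i. u i s) \<longlonglongrightarrow> f s" for u f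
          unfolding ramp_product_def split_beta
          by (intro tendsto_intros that) (use J01 in auto)
      qed
      then show ?thesis by (simp add: integral_distr[OF m_rev m])
    qed
    have "measure ?\<mu> (cylinder J) = measure ?\<nu> (cylinder J)"
    proof (rule LIMSEQ_unique)
      show "(\<lambda>n. \<integral>f. ramp_product n J f \<partial>?\<mu>) \<longlonglongrightarrow> measure ?\<mu> (cylinder J)"
        by (rule tendsto_integral_ramp_product[OF \<mu>.prob_space_axioms _ J(1) J01]) simp
      show "(\<lambda>n. \<integral>f. ramp_product n J f \<partial>?\<mu>) \<longlonglongrightarrow> measure ?\<nu> (cylinder J)"
        unfolding same
        by (rule tendsto_integral_ramp_product[OF \<nu>.prob_space_axioms _ J(1) J01]) simp
    qed
    then show "emeasure ?\<mu> (cylinder J) = emeasure ?\<nu> (cylinder J)"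
      by (simp add: \<mu>.emeasure_eq_measure \<nu>.emeasure_eq_measure)
  qed auto
  then show ?thesis
    using rhs by (simp add: path_reversal_def[abs_def])
qed

end
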